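(* Let $\xi$ be a random connection model on $\mathbb{X}$ based on a Poisson process $\eta$ with diffuse locally finite intensity measure $\lambda$. Assume that $\xi$ has almost surely at most one infinite cluster. Assume further that $\eta_0$ is a point process on $\mathbb{X}$ such that $\mathbb{P}(\eta_0(\mathbb{X})<\infty)=1$ and $\mathbb{P}(\eta_0\le\eta)=1$. Then $\xi[\eta-\eta_0]$ has almost surely at most one infinite cluster.
   Context: Setting. $\mathbb{X}$ is a complete separable metric space with Borel $\sigma$-field; $\lambda$ is a locally finite (finite on bounded Borel sets) and diffuse measure on $\mathbb{X}$; $\varphi\colon\mathbb{X}^2\to[0,1]$ is measurable and symmetric (the connection function) with $\int\varphi(x,y)\,\lambda(dy)<\infty$ for $\lambda$-a.e. $x\in\mathbb{X}$. $\eta$ is a Poisson process on $\mathbb{X}$ with intensity measure $\lambda$, identified with its support, and the random connection model $\xi$ is the random graph with vertex set $\eta$ in which, given $\eta$, each pair of distinct points $x,y\in\eta$ is joined by an edge with probability $\varphi(x,y)$, independently for different pairs. The point process $\eta_0$ is defined on the same probability space as $\xi$ (and may depend on $\xi$). $\xi[\nu]$ denotes the induced subgraph of $\xi$ on the vertices belonging to $\nu$; so $\xi[\eta-\eta_0]$ is $\xi$ with the points of $\eta_0$ and all their edges removed. A cluster is a connected component; it is infinite if it has infinitely many vertices. *)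

theory Defs
  imports "HOL-Probability.Probability"
begin

section \<open>Graphs and clusters\<close>

record 'a graph =
  verts :: "'a set"
  edges :: "'a set set"

definition simple_graph :: "'a graph \<Rightarrow> bool" where
  "simple_graph G \<longleftrightarrow> edges G \<subseteq> {{x, y} | x y. x \<in> verts G \<and> y \<in> verts G \<and> x \<noteq> y}"

definition induced_subgraph :: "'a graph \<Rightarrow> 'a set \<Rightarrow> 'a graph" where
  "induced_subgraph G W = \<lparr>verts = verts G \<inter> W, edges = {e \<in> edges G. e \<subseteq> W}\<rparr>"

definition adjacency :: "'a graph \<Rightarrow> ('a \<times> 'a) set" where
  "adjacency G = {(x, y). x \<in> verts G \<and> y \<in> verts G \<and> {x, y} \<in> edges G}"

definition clusters :: "'a graph \<Rightarrow> 'a set set" where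
  "clusters G = verts G // (adjacency G)\<^sup>*"

definition at_most_one_infinite_cluster :: "'a graph \<Rightarrow> bool" where
  "at_most_one_infinite_cluster G \<longleftrightarrow>
     (\<forall>C\<in>clusters G. \<forall>D\<in>clusters G. infinite C \<longrightarrow> infinite D \<longrightarrow> C = D)"


section \<open>Point processes\<close>

definition locally_finite_measure :: "'a::metric_space measure \<Rightarrow> bool" where
  "locally_finite_measure \<mu> \<longleftrightarrow>
     sets \<mu> = sets borel \<and> (\<forall>B\<in>sets borel. bounded B \<longrightarrow> emeasure \<mu> B < \<infinity>)"

definition diffuse :: "'a measure \<Rightarrow> bool" where
  "diffuse \<mu> \<longleftrightarrow> (\<forall>x. emeasure \<mu> {x} = 0)"

definition counting_measure :: "'a::metric_space measure \<Rightarrow> bool" where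
  "counting_measure \<mu> \<longleftrightarrow>
     locally_finite_measure \<mu> \<and> (\<forall>B\<in>sets borel. emeasure \<mu> B \<in> range of_nat \<union> {\<infinity>})"

text \<open>
  The space of locally finite counting measures, with the \<open>\<sigma>\<close>-algebra generated by the
  evaluations \<open>\<mu> \<mapsto> \<mu>(B)\<close> (built in the same way as \<^const>\<open>subprob_algebra\<close>).
\<close>

definition counting_measure_algebra :: "'a::metric_space measure measure" where
  "counting_measure_algebra =
     (SUP B \<in> sets borel. vimage_algebra {\<mu>. counting_measure \<mu>} (\<lambda>\<mu>. emeasure \<mu> B) borel)"

definition point_process :: "'w measure \<Rightarrow> ('w \<Rightarrow> 'a::metric_space measure) \<Rightarrow> bool" where
  "point_process M \<eta> \<longleftrightarrow> \<eta> \<in> measurable M counting_measure_algebra"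

definition sigma_generated :: "'w measure \<Rightarrow> ('w \<Rightarrow> 'a::metric_space measure) \<Rightarrow> 'w measure" where
  "sigma_generated M \<eta> = vimage_algebra (space M) \<eta> counting_measure_algebra"

text \<open>
  For a locally finite counting measure on a separable metric space the set of atoms is the
  (topological) support.
\<close>

definition points :: "'a measure \<Rightarrow> 'a set" where
  "points \<mu> = {x. emeasure \<mu> {x} \<noteq> 0}"

text \<open>
  Rate \<open>0\<close> gives the point mass at \<open>0\<close> and rate \<open>\<infinity>\<close> the point mass at \<open>\<infinity>\<close>; \<^const>\<open>poisson_pmf\<close>
  is only specified for rates in \<open>(0, \<infinity>)\<close>.
\<close>

definition poisson_distributed :: "'w measure \<Rightarrow> ('w \<Rightarrow> ennreal) \<Rightarrow> ennreal \<Rightarrow> bool" where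
  "poisson_distributed M N r \<longleftrightarrow>
     N \<in> borel_measurable M \<and>
     (if r = \<infinity> then AE \<omega> in M. N \<omega> = \<infinity>
      else \<forall>k::nat. measure M {\<omega> \<in> space M. N \<omega> = of_nat k} =
             enn2real r ^ k / fact k * exp (- enn2real r))"

definition poisson_process ::
    "'w measure \<Rightarrow> 'a::metric_space measure \<Rightarrow> ('w \<Rightarrow> 'a measure) \<Rightarrow> bool" where
  "poisson_process M \<Lambda> \<eta> \<longleftrightarrow>
     point_process M \<eta> \<and>
     (\<forall>B\<in>sets borel. poisson_distributed M (\<lambda>\<omega>. emeasure (\<eta> \<omega>) B) (emeasure \<Lambda> B)) \<and>
     (\<forall>(m::nat) B. B ` {..<m} \<subseteq> sets borel \<longrightarrow> disjoint_family_on B {..<m} \<longrightarrow>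
        prob_space.indep_vars M (\<lambda>_. borel) (\<lambda>i \<omega>. emeasure (\<eta> \<omega>) (B i)) {..<m})"


section \<open>The random connection model\<close>

definition connection_function ::
    "'a::metric_space measure \<Rightarrow> ('a \<Rightarrow> 'a \<Rightarrow> real) \<Rightarrow> bool" where
  "connection_function \<Lambda> \<phi> \<longleftrightarrow>
     case_prod \<phi> \<in> borel_measurable (borel \<Otimes>\<^sub>M borel) \<and>
     (\<forall>x y. 0 \<le> \<phi> x y \<and> \<phi> x y \<le> 1) \<and>
     (\<forall>x y. \<phi> x y = \<phi> y x) \<and>
     (AE x in \<Lambda>. (\<integral>\<^sup>+ y. ennreal (\<phi> x y) \<partial>\<Lambda>) < \<infinity>)"

text \<open>
  \<open>X 0, X 1, \<dots>\<close> (of length \<open>\<kappa>\<close>) lists the points of \<open>\<eta>\<close> without repetition, in a way that depends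
  measurably on \<open>\<eta>\<close> alone.
\<close>

definition enumerates_points ::
    "'w measure \<Rightarrow> ('w \<Rightarrow> 'a::metric_space measure) \<Rightarrow> ('w \<Rightarrow> enat) \<Rightarrow> (nat \<Rightarrow> 'w \<Rightarrow> 'a) \<Rightarrow> bool" where
  "enumerates_points M \<eta> \<kappa> X \<longleftrightarrow>
     \<kappa> \<in> measurable (sigma_generated M \<eta>) (count_space UNIV) \<and>
     (\<forall>n. X n \<in> measurable (sigma_generated M \<eta>) borel) \<and>
     (\<forall>\<omega>\<in>space M. bij_betw (\<lambda>n. X n \<omega>) {n. enat n < \<kappa> \<omega>} (points (\<eta> \<omega>)))"

definition edge_event ::
    "'w measure \<Rightarrow> ('w \<Rightarrow> 'a graph) \<Rightarrow> ('w \<Rightarrow> enat) \<Rightarrow> (nat \<Rightarrow> 'w \<Rightarrow> 'a) \<Rightarrow> nat \<Rightarrow> nat \<Rightarrow> 'w set" where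
  "edge_event M \<xi> \<kappa> X m n =
     {\<omega> \<in> space M. enat m < \<kappa> \<omega> \<and> enat n < \<kappa> \<omega> \<and> {X m \<omega>, X n \<omega>} \<in> edges (\<xi> \<omega>)}"

text \<open>
  The last clause says that conditionally on \<open>\<eta>\<close> the edge indicators of distinct pairs of points
  are independent with success probabilities \<open>\<phi>(X m, X n)\<close>. Prescribing the conditional
  probabilities of all finite intersections of edge events determines the conditional joint law of
  the indicators. For the event that the listed points all exist the factor with
  \<open>\<kappa>\<close> is \<open>1\<close>; otherwise both sides vanish. The edges need not be functions of \<open>\<eta>\<close> and auxiliary
  uniform variables on the given probability space.
\<close>

definition random_connection_model ::
    "'w measure \<Rightarrow> ('a::metric_space \<Rightarrow> 'a \<Rightarrow> real) \<Rightarrow> ('w \<Rightarrow> 'a measure) \<Rightarrow> ('w \<Rightarrow> 'a graph) \<Rightarrow> bool" where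
  "random_connection_model M \<phi> \<eta> \<xi> \<longleftrightarrow>
     (\<forall>\<omega>\<in>space M. simple_graph (\<xi> \<omega>) \<and> verts (\<xi> \<omega>) = points (\<eta> \<omega>)) \<and>
     (\<exists>\<kappa> X. enumerates_points M \<eta> \<kappa> X \<and>
        (\<forall>m n. m < n \<longrightarrow> edge_event M \<xi> \<kappa> X m n \<in> sets M) \<and>
        (\<forall>F. finite F \<longrightarrow> F \<subseteq> {(m, n). m < n} \<longrightarrow>
           (AE \<omega> in M.
              real_cond_exp M (sigma_generated M \<eta>)
                (\<lambda>\<omega>'. \<Prod>(m, n)\<in>F. indicator (edge_event M \<xi> \<kappa> X m n) \<omega>') \<omega> =
              (\<Prod>(m, n)\<in>F. if enat n < \<kappa> \<omega> then \<phi> (X m \<omega>) (X n \<omega>) else 0))))"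

end

theory Submission
  imports Defs
begin

text \<open>
  Fix a bounded Borel set \<open>B\<close> and delete all points of \<open>\<eta>\<close> in \<open>B\<close>. The remaining graph is independent
  of the event that \<open>\<eta>\<close> has no point in \<open>B\<close>, and this event has the positive probability
  \<open>exp (- \<Lambda>(B))\<close>. When it occurs nothing is deleted and the remaining graph is \<open>\<xi>\<close> itself. So if the
  remaining graph had two infinite clusters with positive probability, then \<open>\<xi>\<close> would have two
  infinite clusters with positive probability as well. This is
  \<open>AE_at_most_one_infinite_cluster_outside\<close>. As \<open>\<eta>\<close> is locally finite, each finite set of its points is
  cut out by a finite union of sets from a countable base. There are countably many such unions,
  so almost surely the conclusion holds for all of them at once, and hence for the removal of any
  random finite set of points, however it depends on \<open>\<xi>\<close>.

  The substance is the independence (\<open>indep_outside_graph\<close>). The law of \<open>\<xi>\<close> is prescribed through a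
  numbering of the points, and the number of a point outside \<open>B\<close> may depend on the points inside
  \<open>B\<close>. The argument therefore passes to events that do not mention the numbering: for a Borel set
  \<open>C\<close> and a bounded symmetric set \<open>D\<close> of pairs, both avoiding \<open>B\<close>, the event that \<open>C\<close> contains no
  point and \<open>D\<close> contains no edge. These events are stable under intersection. Given \<open>\<eta>\<close>, the
  absence of edges in \<open>D\<close> has probability \<open>\<Prod>(1 - \<phi>(x, y))\<close>, the product being taken over the
  unordered pairs of distinct points in \<open>D\<close> (\<open>prob_no_edge_event_Int\<close>), and this product is a measurable function of the void
  events outside \<open>B\<close> alone (\<open>measurable_prod_offdiag_if_void_measurable\<close>). Void events of disjoint sets
  are independent by the definition of a Poisson process.

  It remains to see that the existence of two infinite clusters outside \<open>B\<close> belongs to the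
  \<open>\<sigma>\<close>-algebra generated by these events. To this end vertices are represented by base sets that
  contain no other vertex, which turns paths and infinite clusters into countable combinations
  of the generating events (\<open>not_at_most_one_infinite_cluster_iff_base\<close>).
\<close>

section \<open>Locally finite counting measures\<close>

lemma counting_measure_atom_ge_1:
  assumes "counting_measure \<mu>" "x \<in> points \<mu>"
  shows "1 \<le> emeasure \<mu> {x}"
proof -
  have "emeasure \<mu> {x} \<in> range of_nat \<union> {\<infinity>}" "emeasure \<mu> {x} \<noteq> 0"
    using assms by (auto simp: counting_measure_def points_def)
  then consider n where "emeasure \<mu> {x} = of_nat n" "n \<noteq> 0" | "emeasure \<mu> {x} = \<infinity>"
    by fastforce
  then show ?thesis
  proof cases
    case 1
    then show ?thesis
      using of_nat_le_iff[where 'a=ennreal, of 1 n] by simp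
  qed simp
qed

lemma sets_counting_measure: "counting_measure \<mu> \<Longrightarrow> sets \<mu> = sets borel"
  by (auto simp: counting_measure_def locally_finite_measure_def)

lemma finite_points_if_finite_emeasure:
  assumes \<mu>: "counting_measure \<mu>" and C: "C \<in> sets borel" and fin: "emeasure \<mu> C < \<infinity>"
  shows "finite (points \<mu> \<inter> C)"
proof (rule ccontr)
  assume inf: "infinite (points \<mu> \<inter> C)"
  obtain n :: nat where n: "emeasure \<mu> C = of_nat n"
    using \<mu> C fin by (auto simp: counting_measure_def)
  obtain T where T: "T \<subseteq> points \<mu> \<inter> C" "finite T" "card T = Suc n"
    using infinite_arbitrarily_large[OF inf] by metis
  have "of_nat (Suc n) = (\<Sum>x\<in>T. 1 :: ennreal)"
    using T by simp
  also have "\<dots> \<le> (\<Sum>x\<in>T. emeasure \<mu> {x})"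
    using T \<mu> by (intro sum_mono counting_measure_atom_ge_1) auto
  also have "\<dots> = emeasure \<mu> T"
    using T by (intro emeasure_eq_sum_singleton[symmetric]) (auto simp: sets_counting_measure[OF \<mu>])
  also have "\<dots> \<le> emeasure \<mu> C"
    using T C by (intro emeasure_mono) (auto simp: sets_counting_measure[OF \<mu>])
  finally show False
    unfolding n using of_nat_le_iff[where 'a=ennreal, of "Suc n" n] by simp
qed

lemma finite_points_bounded:
  fixes \<mu> :: "'a::metric_space measure"
  assumes \<mu>: "counting_measure \<mu>" and C: "bounded C"
  shows "finite (points \<mu> \<inter> C)"
proof -
  have "bounded (closure C)" "closure C \<in> sets borel"
    using C by auto
  then have "finite (points \<mu> \<inter> closure C)"
    using \<mu> by (intro finite_points_if_finite_emeasure)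
      (auto simp: counting_measure_def locally_finite_measure_def)
  then show ?thesis
    by (rule finite_subset[rotated]) (use closure_subset in auto)
qed

text \<open>
  A counting measure has no diffuse part: the measures of the balls around a point which is not an
  atom are integers that decrease to \<open>0\<close>, so that one of them vanishes, and by separability
  countably many base sets inside such balls cover everything.
\<close>

lemma emeasure_eq_0_iff_no_points:
  fixes \<mu> :: "'a::{metric_space, second_countable_topology} measure"
  assumes \<mu>: "counting_measure \<mu>" and C: "C \<in> sets borel"
  shows "emeasure \<mu> C = 0 \<longleftrightarrow> points \<mu> \<inter> C = {}"
proof
  note [simp] = sets_counting_measure[OF \<mu>]
  show "points \<mu> \<inter> C = {}" if "emeasure \<mu> C = 0"
  proof (rule ccontr)
    assume "points \<mu> \<inter> C \<noteq> {}"
    then obtain x where x: "x \<in> points \<mu>" "x \<in> C"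
      by auto
    then have "emeasure \<mu> {x} \<le> emeasure \<mu> C"
      using C by (intro emeasure_mono) auto
    with counting_measure_atom_ge_1[OF \<mu> x(1)] that show False
      by simp
  qed
  assume no: "points \<mu> \<inter> C = {}"
  obtain \<B> :: "'a set set" where \<B>: "countable \<B>" "topological_basis \<B>"
    using ex_countable_basis by auto
  have *: "\<exists>U\<in>\<B>. x \<in> U \<and> emeasure \<mu> (C \<inter> U) = 0" for x
  proof -
    define A where "A n = C \<inter> ball x (1 / Suc n)" for n
    have A: "A n \<in> sets \<mu>" for n
      using C by (auto simp: A_def)
    have dec: "decseq A"
      unfolding decseq_def A_def by (intro allI impI Int_mono order_refl subset_ball) (simp add: frac_le)
    have fin: "emeasure \<mu> (A n) \<noteq> \<infinity>" for n
    proof -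
      have "bounded (A n)" 
        unfolding A_def by (rule bounded_subset[OF bounded_ball[of x "1 / Suc n"]]) auto
      with \<mu> A show ?thesis
        unfolding counting_measure_def locally_finite_measure_def by force
    qed
    have "(\<Inter>n. A n) = C \<inter> {x}"
    proof -
      have "y = x" if "\<And>n. dist x y < 1 / Suc n" for y
      proof (rule ccontr)
        assume "y \<noteq> x"
        then obtain n where "1 / Suc n < dist x y"
          using nat_approx_posE[of "dist x y"] by (metis zero_less_dist_iff inverse_eq_divide)
        with that[of n] show False by simp
      qed
      then show ?thesis by (auto simp: A_def)
    qed
    moreover have "emeasure \<mu> (C \<inter> {x}) = 0"
      using no by (cases "x \<in> C") (auto simp: points_def)
    ultimately have "(\<lambda>n. emeasure \<mu> (A n)) \<longlonglongrightarrow> 0"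
      using Lim_emeasure_decseq[of A \<mu>] A dec fin by auto
    then have "\<forall>\<^sub>F n in sequentially. emeasure \<mu> (A n) < 1"
      by (rule order_tendstoD) simp
    then obtain n where n: "emeasure \<mu> (A n) < 1"
      by (auto simp: eventually_sequentially)
    moreover have "emeasure \<mu> (A n) \<in> range of_nat \<union> {\<infinity>}"
      using A[of n] \<mu> by (auto simp: counting_measure_def)
    ultimately obtain k where k: "emeasure \<mu> (A n) = of_nat k"
      by auto
    with n have 0: "emeasure \<mu> (A n) = 0"
      using of_nat_less_iff[where 'a=ennreal, of k 1] by simp
    obtain U where U: "U \<in> \<B>" "x \<in> U" "U \<subseteq> ball x (1 / Suc n)"
      using topological_basisE[OF \<B>(2), of "ball x (1 / Suc n)" x] by auto
    have "emeasure \<mu> (C \<inter> U) \<le> emeasure \<mu> (A n)"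
      using U A[of n] by (intro emeasure_mono) (auto simp: A_def)
    with 0 U show ?thesis by auto
  qed
  define \<N> where "\<N> = {U \<in> \<B>. emeasure \<mu> (C \<inter> U) = 0}"
  have "(\<Union>U\<in>\<N>. C \<inter> U) \<in> null_sets \<mu>"
  proof (rule null_sets_UN')
    show "countable \<N>"
      using \<B>(1) by (auto simp: \<N>_def)
    show "C \<inter> U \<in> null_sets \<mu>" if "U \<in> \<N>" for U
      using that C topological_basis_open[OF \<B>(2)] by (auto simp: \<N>_def null_sets_def)
  qed
  moreover have "(\<Union>U\<in>\<N>. C \<inter> U) = C"
    using * by (auto simp: \<N>_def)
  ultimately show "emeasure \<mu> C = 0"
    by auto
qed

lemma measurable_emeasure_counting_measure_algebra:
  "B \<in> sets borel \<Longrightarrow> (\<lambda>\<mu>. emeasure \<mu> B) \<in> borel_measurable counting_measure_algebra"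
  by (auto intro!: measurable_Sup1 measurable_vimage_algebra1 simp: counting_measure_algebra_def)

lemma space_counting_measure_algebra:
  "space counting_measure_algebra = {\<mu> :: 'a::metric_space measure. counting_measure \<mu>}"
  by (auto simp: counting_measure_algebra_def space_Sup_eq_UN)

section \<open>A countable base of bounded open sets\<close>

definition bounded_base :: "(nat \<Rightarrow> 'a::metric_space set) \<Rightarrow> bool" where
  "bounded_base b \<longleftrightarrow>
     (\<forall>i. open (b i) \<and> bounded (b i)) \<and> (\<forall>x U. open U \<longrightarrow> x \<in> U \<longrightarrow> (\<exists>i. x \<in> b i \<and> b i \<subseteq> U))"

lemma ex_bounded_base: "\<exists>b :: nat \<Rightarrow> 'a::{metric_space, second_countable_topology} set. bounded_base b"
proof -
  obtain \<B> :: "'a set set" where \<B>: "countable \<B>" "topological_basis \<B>"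
    using ex_countable_basis by auto
  define \<C> where "\<C> = insert {} {U \<in> \<B>. bounded U}"
  have \<C>: "countable \<C>" "\<C> \<noteq> {}"
    using \<B> by (auto simp: \<C>_def)
  have "bounded_base (from_nat_into \<C>)"
    unfolding bounded_base_def
  proof (intro conjI allI impI)
    fix i
    have "from_nat_into \<C> i \<in> \<C>"
      using \<C>(2) by (rule from_nat_into)
    then show "open (from_nat_into \<C> i)" "bounded (from_nat_into \<C> i)"
      using topological_basis_open[OF \<B>(2)] by (auto simp: \<C>_def)
  next
    fix x :: 'a and U assume "open U" "x \<in> U"
    then obtain V where V: "V \<in> \<B>" "x \<in> V" "V \<subseteq> U \<inter> ball x 1"
      using topological_basisE[OF \<B>(2), of "U \<inter> ball x 1" x] by auto
    then have "V \<in> \<C>"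
      by (auto simp: \<C>_def intro: bounded_subset[OF bounded_ball])
    then show "\<exists>i. x \<in> from_nat_into \<C> i \<and> from_nat_into \<C> i \<subseteq> U"
      using V from_nat_into_to_nat_on[OF \<C>(1)] by (metis le_inf_iff)
  qed
  then show ?thesis
    by blast
qed

definition locally_finite_set :: "'a::metric_space set \<Rightarrow> bool" where
  "locally_finite_set P \<longleftrightarrow> (\<forall>C. bounded C \<longrightarrow> finite (P \<inter> C))"

lemma isolating_base_set:
  assumes b: "bounded_base b" and P: "locally_finite_set P" and x: "x \<in> P" "x \<in> U" "open U"
  shows "\<exists>i. x \<in> b i \<and> b i \<subseteq> U \<and> P \<inter> b i = {x}"
proof -
  have "finite (P \<inter> ball x 1 - {x})"
    using P by (auto simp: locally_finite_set_def)
  then have "open (U \<inter> ball x 1 - (P \<inter> ball x 1 - {x}))"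
    using x by (intro open_Diff finite_imp_closed open_Int) auto
  then obtain i where "x \<in> b i" "b i \<subseteq> U \<inter> ball x 1 - (P \<inter> ball x 1 - {x})"
    using b x unfolding bounded_base_def by (metis DiffI Diff_iff IntI centre_in_ball insertI1 zero_less_one)
  then show ?thesis
    using x by (intro exI[of _ i]) auto
qed

section \<open>Functionals of a locally finite random set determined by its void events\<close>

text \<open>
  The bits recording membership in the first \<open>n\<close> base sets separate the points of a finite set for
  large \<open>n\<close>. Counting the bit patterns that occur therefore counts the points, and each pattern
  occurs precisely when a Borel set is not void.
\<close>

lemma measurable_card_if_void_measurable:
  fixes P :: "'w \<Rightarrow> 'a::{metric_space, second_countable_topology} set"
  assumes lf: "\<And>\<omega>. \<omega> \<in> space G \<Longrightarrow> locally_finite_set (P \<omega>)"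
    and void: "\<And>C. C \<in> sets borel \<Longrightarrow> C \<subseteq> K \<Longrightarrow> {\<omega> \<in> space G. P \<omega> \<inter> C = {}} \<in> sets G"
    and C: "C \<in> sets borel" "C \<subseteq> K" "bounded C"
  shows "(\<lambda>\<omega>. real (card (P \<omega> \<inter> C))) \<in> borel_measurable G"
proof -
  obtain b :: "nat \<Rightarrow> 'a set" where b: "bounded_base b"
    using ex_bounded_base by auto
  have [measurable]: "b i \<in> sets borel" for i
    using b by (auto simp: bounded_base_def)
  define pat where "pat n x = {i\<in>{..<n}. x \<in> b i}" for n x
  define cell where "cell n T = {x. pat n x = T}" for n :: nat and T
  have cell_borel: "cell n T \<in> sets borel" for n T
  proof -
    have "cell n T = (if T \<subseteq> {..<n} then {x. \<forall>i\<in>{..<n}. (x \<in> b i) = (i \<in> T)} else {})"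
      by (auto simp: cell_def pat_def)
    also have "\<dots> \<in> sets borel"
      by (simp, measurable)
    finally show ?thesis .
  qed
  have fin: "finite (P \<omega> \<inter> C)" if "\<omega> \<in> space G" for \<omega>
    using lf[OF that] C by (auto simp: locally_finite_set_def)
  have count: "real (card (pat n ` (P \<omega> \<inter> C))) =
      (\<Sum>T\<in>Pow {..<n}. indicator {\<omega>. P \<omega> \<inter> (C \<inter> cell n T) \<noteq> {}} \<omega>)" for n \<omega>
  proof -
    have "pat n ` (P \<omega> \<inter> C) = {T \<in> Pow {..<n}. P \<omega> \<inter> (C \<inter> cell n T) \<noteq> {}}"
      by (auto simp: cell_def pat_def)
    moreover have "(\<Sum>T\<in>Pow {..<n}. indicator {\<omega>. P \<omega> \<inter> (C \<inter> cell n T) \<noteq> {}} \<omega>) =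
        (\<Sum>T\<in>Pow {..<n}. if P \<omega> \<inter> (C \<inter> cell n T) \<noteq> {} then 1 else 0 :: real)"
      by (intro sum.cong) (auto simp: indicator_def)
    moreover have "\<dots> = real (card {T \<in> Pow {..<n}. P \<omega> \<inter> (C \<inter> cell n T) \<noteq> {}})"
      by (simp flip: sum.inter_filter)
    ultimately show ?thesis
      by metis
  qed
  have meas: "(\<lambda>\<omega>. real (card (pat n ` (P \<omega> \<inter> C)))) \<in> borel_measurable G" for n
  proof -
    have "{\<omega> \<in> space G. \<not> P \<omega> \<inter> (C \<inter> cell n T) = {}} \<in> sets G" for T
      using void[of "C \<inter> cell n T"] C cell_borel[of n T] by (intro sets.sets_Collect_neg) auto
    then have "(\<lambda>\<omega>. indicator {\<omega>. P \<omega> \<inter> (C \<inter> cell n T) \<noteq> {}} \<omega> :: real) \<in> borel_measurable G" for T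
      by (intro borel_measurable_indicator') (auto simp: Int_def conj_commute)
    then show ?thesis
      unfolding count by (intro borel_measurable_sum)
  qed
  show ?thesis
  proof (rule borel_measurable_LIMSEQ_real[OF _ meas])
    fix \<omega> assume \<omega>: "\<omega> \<in> space G"
    let ?F = "P \<omega> \<inter> C"
    have "\<exists>i. x \<in> b i \<and> y \<notin> b i" if "x \<noteq> y" for x y
      using b that open_Compl[OF closed_singleton[of y]] unfolding bounded_base_def by fastforce
    then obtain s where s: "\<And>x y. x \<noteq> y \<Longrightarrow> x \<in> b (s x y) \<and> y \<notin> b (s x y)"
      by metis
    have fin': "finite ((\<lambda>(x, y). s x y) ` (?F \<times> ?F))"
      using fin[OF \<omega>] by auto
    obtain N where N: "\<And>x y. x \<in> ?F \<Longrightarrow> y \<in> ?F \<Longrightarrow> s x y < N"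
      using finite_nat_set_iff_bounded[THEN iffD1, OF fin'] by (auto simp: Ball_def image_iff)
    have "card (pat n ` ?F) = card ?F" if "n \<ge> N" for n
    proof (rule card_image, rule inj_onI, rule ccontr)
      fix x y assume xy: "x \<in> ?F" "y \<in> ?F" "pat n x = pat n y" "x \<noteq> y"
      have "s x y < n"
        using N xy that by force
      with s[OF xy(4)] have "s x y \<in> pat n x" "s x y \<notin> pat n y"
        by (auto simp: pat_def)
      with xy(3) show False by simp
    qed
    then show "(\<lambda>n. real (card (pat n ` ?F))) \<longlonglongrightarrow> real (card ?F)"
      by (intro tendsto_eventually eventually_sequentiallyI[of N]) simp
  qed
qed

definition offdiag :: "'a set \<Rightarrow> ('a \<times> 'a) set" where
  "offdiag P = {(x, y). x \<in> P \<and> y \<in> P \<and> x \<noteq> y}"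

lemma finite_offdiag_Int:
  assumes "finite (P \<inter> K)" "D \<subseteq> K \<times> K"
  shows "finite (offdiag P \<inter> D)"
  by (rule finite_subset[of _ "(P \<inter> K) \<times> (P \<inter> K)"]) (use assms in \<open>auto simp: offdiag_def\<close>)

lemma measure_count_space_Int: "finite F \<Longrightarrow> measure (count_space F) (F \<inter> S) = real (card (F \<inter> S))"
  using emeasure_count_space_finite[of "F \<inter> S" F] by (simp add: measure_def)

text \<open>
  Rectangles reduce to the number of points in a set, and a Dynkin system argument extends this to
  all measurable sets of pairs. The restriction to a bounded \<open>K\<close> keeps the counts finite, so that
  complements correspond to differences.
\<close>

lemma measurable_card_offdiag_if_void_measurable:
  fixes P :: "'w \<Rightarrow> 'a::{metric_space, second_countable_topology} set"
  assumes lf: "\<And>\<omega>. \<omega> \<in> space G \<Longrightarrow> locally_finite_set (P \<omega>)"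
    and void: "\<And>C. C \<in> sets borel \<Longrightarrow> C \<subseteq> K \<Longrightarrow> {\<omega> \<in> space G. P \<omega> \<inter> C = {}} \<in> sets G"
    and K: "K \<in> sets borel" "bounded K"
    and D: "D \<in> sets (borel \<Otimes>\<^sub>M borel)"
  shows "(\<lambda>\<omega>. real (card (offdiag (P \<omega>) \<inter> D \<inter> K \<times> K))) \<in> borel_measurable G"
proof -
  have fin: "finite (P \<omega> \<inter> K)" "finite (offdiag (P \<omega>) \<inter> D \<inter> K \<times> K)" if "\<omega> \<in> space G" for \<omega> D
  proof -
    show "finite (P \<omega> \<inter> K)"
      using lf[OF that] K by (auto simp: locally_finite_set_def)
    then show "finite (offdiag (P \<omega>) \<inter> D \<inter> K \<times> K)"
      unfolding Int_assoc by (rule finite_offdiag_Int) auto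
  qed
  have bdd: "bounded (K \<inter> U)" for U
    using K by (auto intro: bounded_subset)
  have "D \<in> sigma_sets (space borel \<times> space borel) {a \<times> b |a b. a \<in> sets (borel :: 'a measure) \<and> b \<in> sets (borel :: 'a measure)}"
    using D by (simp add: sets_pair_measure)
  then have "(\<lambda>\<omega>. real (card (offdiag (P \<omega>) \<inter> D \<inter> K \<times> K))) \<in> borel_measurable G"
  proof (induction rule: sigma_sets_induct_disjoint[OF Int_stable_pair_measure_generator pair_measure_closed,
        consumes 1, case_names basic empty compl union])
    case (basic A)
    then obtain U V where UV: "A = U \<times> V" "U \<in> sets borel" "V \<in> sets borel"
      by auto
    \<comment> \<open>Count all pairs in the rectangle and remove the diagonal.\<close>
    have "real (card (offdiag (P \<omega>) \<inter> A \<inter> K \<times> K)) =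
        real (card (P \<omega> \<inter> (K \<inter> U))) * real (card (P \<omega> \<inter> (K \<inter> V))) - real (card (P \<omega> \<inter> (K \<inter> (U \<inter> V))))"
      if "\<omega> \<in> space G" for \<omega>
    proof -
      let ?R = "(P \<omega> \<inter> (K \<inter> U)) \<times> (P \<omega> \<inter> (K \<inter> V))" and ?I = "(\<lambda>x. (x, x)) ` (P \<omega> \<inter> (K \<inter> (U \<inter> V)))"
      have f: "finite (P \<omega> \<inter> (K \<inter> S))" for S
        using fin(1)[OF that] by (rule finite_subset[rotated]) auto
      have eq: "?R = (offdiag (P \<omega>) \<inter> A \<inter> K \<times> K) \<union> ?I"
        by (auto simp: offdiag_def UV)
      have "card ?R = card (offdiag (P \<omega>) \<inter> A \<inter> K \<times> K) + card ?I"
        unfolding eq using fin(2)[OF that] f by (intro card_Un_disjoint) (auto simp: offdiag_def)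
      moreover have "card ?I = card (P \<omega> \<inter> (K \<inter> (U \<inter> V)))"
        by (intro card_image) (auto simp: inj_on_def)
      ultimately have "card (P \<omega> \<inter> (K \<inter> U)) * card (P \<omega> \<inter> (K \<inter> V)) =
          card (offdiag (P \<omega>) \<inter> A \<inter> K \<times> K) + card (P \<omega> \<inter> (K \<inter> (U \<inter> V)))"
        by (simp add: card_cartesian_product)
      then have "real (card (P \<omega> \<inter> (K \<inter> U))) * real (card (P \<omega> \<inter> (K \<inter> V))) =
          real (card (offdiag (P \<omega>) \<inter> A \<inter> K \<times> K)) + real (card (P \<omega> \<inter> (K \<inter> (U \<inter> V))))"
        by (metis of_nat_add of_nat_mult)
      then show ?thesis by simp
    qed
    moreover have "(\<lambda>\<omega>. real (card (P \<omega> \<inter> (K \<inter> S)))) \<in> borel_measurable G" if "S \<in> sets borel" for S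
      using measurable_card_if_void_measurable[of G P K "K \<inter> S", OF lf void] K that bdd by auto
    ultimately show ?case
      using UV by (subst measurable_cong) (auto intro!: borel_measurable_diff borel_measurable_times)
  next
    case empty
    then show ?case by simp
  next
    case (compl A)
    have all: "(\<lambda>\<omega>. real (card (P \<omega> \<inter> K)) * real (card (P \<omega> \<inter> K)) - real (card (P \<omega> \<inter> K))) \<in> borel_measurable G"
      using measurable_card_if_void_measurable[of G P K K, OF lf void] K by auto
    have "real (card (offdiag (P \<omega>) \<inter> (space borel \<times> space borel - A) \<inter> K \<times> K)) =
        (real (card (P \<omega> \<inter> K)) * real (card (P \<omega> \<inter> K)) - real (card (P \<omega> \<inter> K)))
        - real (card (offdiag (P \<omega>) \<inter> A \<inter> K \<times> K))"
      if "\<omega> \<in> space G" for \<omega>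
    proof -
      let ?R = "(P \<omega> \<inter> K) \<times> (P \<omega> \<inter> K)" and ?I = "(\<lambda>x. (x, x)) ` (P \<omega> \<inter> K)"
      let ?A = "offdiag (P \<omega>) \<inter> A \<inter> K \<times> K" and ?B = "offdiag (P \<omega>) \<inter> (space borel \<times> space borel - A) \<inter> K \<times> K"
      have eq: "?R = (?A \<union> ?B) \<union> ?I"
        by (auto simp: offdiag_def)
      have "card ?R = card (?A \<union> ?B) + card ?I"
        unfolding eq using fin[OF that] by (intro card_Un_disjoint) (auto simp: offdiag_def)
      also have "card (?A \<union> ?B) = card ?A + card ?B"
        using fin[OF that] by (intro card_Un_disjoint) (auto simp: offdiag_def)
      also have "card ?I = card (P \<omega> \<inter> K)"
        by (intro card_image) (auto simp: inj_on_def)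
      finally have "card (P \<omega> \<inter> K) * card (P \<omega> \<inter> K) = card ?A + card ?B + card (P \<omega> \<inter> K)"
        by (simp add: card_cartesian_product)
      then have "real (card (P \<omega> \<inter> K)) * real (card (P \<omega> \<inter> K)) = real (card ?A) + real (card ?B) + real (card (P \<omega> \<inter> K))"
        by (metis of_nat_add of_nat_mult)
      then show ?thesis by simp
    qed
    then show ?case
      by (rule measurable_cong[THEN iffD2, OF _ borel_measurable_diff[OF all compl.IH]])
  next
    case (union A)
    have "(\<lambda>n. \<Sum>i<n. real (card (offdiag (P \<omega>) \<inter> A i \<inter> K \<times> K))) \<longlonglongrightarrow>
        real (card (offdiag (P \<omega>) \<inter> (\<Union>i. A i) \<inter> K \<times> K))" if "\<omega> \<in> space G" for \<omega>
    proof -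
      let ?F = "offdiag (P \<omega>) \<inter> K \<times> K"
      have F: "finite ?F"
        using fin(2)[OF that, of UNIV] by simp
      have eq: "real (card (offdiag (P \<omega>) \<inter> S \<inter> K \<times> K)) = measure (count_space ?F) (?F \<inter> S)" for S
      proof -
        have "offdiag (P \<omega>) \<inter> S \<inter> K \<times> K = ?F \<inter> S" by auto
        with measure_count_space_Int[OF F, of S] show ?thesis by (simp only:)
      qed
      interpret finite_measure "count_space ?F"
        by (rule finite_measure_count_space[OF F])
      have "(\<lambda>i. measure (count_space ?F) (?F \<inter> A i)) sums measure (count_space ?F) (\<Union>i. ?F \<inter> A i)"
        using union.hyps by (intro finite_measure_UNION) (auto simp: disjoint_family_on_def)
      moreover have "(\<Union>i. ?F \<inter> A i) = ?F \<inter> (\<Union>i. A i)"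
        by auto
      ultimately have "(\<lambda>i. measure (count_space ?F) (?F \<inter> A i)) sums measure (count_space ?F) (?F \<inter> (\<Union>i. A i))"
        by metis
      then show ?thesis
        unfolding eq[of "A _", symmetric] eq[of "\<Union>i. A i", symmetric] sums_def .
    qed
    then show ?case
      by (rule borel_measurable_LIMSEQ_real) (use union.IH in auto)
  qed
  then show ?thesis .
qed

text \<open>
  If \<open>\<psi>\<close> takes finitely many values, the product depends on the number of pairs in each level set.
  The general case follows by approximation, because for each \<open>\<omega>\<close> the product is finite.
\<close>

lemma measurable_prod_offdiag_if_void_measurable:
  fixes P :: "'w \<Rightarrow> 'a::{metric_space, second_countable_topology} set"
  assumes lf: "\<And>\<omega>. \<omega> \<in> space G \<Longrightarrow> locally_finite_set (P \<omega>)"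
    and void: "\<And>C. C \<in> sets borel \<Longrightarrow> C \<subseteq> K \<Longrightarrow> {\<omega> \<in> space G. P \<omega> \<inter> C = {}} \<in> sets G"
    and K: "K \<in> sets borel" "bounded K"
    and D: "D \<in> sets (borel \<Otimes>\<^sub>M borel)" "D \<subseteq> K \<times> K"
    and \<psi>: "\<psi> \<in> borel_measurable (borel \<Otimes>\<^sub>M borel)"
  shows "(\<lambda>\<omega>. \<Prod>z\<in>offdiag (P \<omega>) \<inter> D. \<psi> z :: real) \<in> borel_measurable G"
proof -
  have fin: "finite (offdiag (P \<omega>) \<inter> D)" if "\<omega> \<in> space G" for \<omega>
    using lf[OF that] K D by (intro finite_offdiag_Int[of _ K]) (auto simp: locally_finite_set_def)
  obtain s where s: "\<And>i. simple_function (borel \<Otimes>\<^sub>M borel) (s i)" "\<And>z. (\<lambda>i. s i z) \<longlonglongrightarrow> \<psi> z"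
    using borel_measurable_implies_sequence_metric[OF \<psi>, of 0] by (auto simp: space_pair_measure)
  show ?thesis
  proof (rule borel_measurable_LIMSEQ_real)
    show "(\<lambda>i. \<Prod>z\<in>offdiag (P \<omega>) \<inter> D. s i z) \<longlonglongrightarrow> (\<Prod>z\<in>offdiag (P \<omega>) \<inter> D. \<psi> z)" for \<omega>
      by (intro tendsto_prod s)
    fix i
    let ?V = "range (s i)"
    have V: "finite ?V"
      using s(1)[of i] by (simp add: simple_function_def space_pair_measure)
    \<comment> \<open>A product of finitely many values is determined by how often each value occurs.\<close>
    have "(\<Prod>z\<in>offdiag (P \<omega>) \<inter> D. s i z) =
        (\<Prod>v\<in>?V. v ^ card (offdiag (P \<omega>) \<inter> (D \<inter> s i -` {v}) \<inter> K \<times> K))" if "\<omega> \<in> space G" for \<omega>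
    proof -
      have "(\<Prod>z\<in>offdiag (P \<omega>) \<inter> D. s i z) =
          (\<Prod>v\<in>?V. \<Prod>z\<in>{z \<in> offdiag (P \<omega>) \<inter> D. s i z = v}. s i z)"
        using fin[OF that] V by (intro prod.group[symmetric]) auto
      also have "\<dots> = (\<Prod>v\<in>?V. v ^ card {z \<in> offdiag (P \<omega>) \<inter> D. s i z = v})"
        by (intro prod.cong) auto
      also have "\<dots> = (\<Prod>v\<in>?V. v ^ card (offdiag (P \<omega>) \<inter> (D \<inter> s i -` {v}) \<inter> K \<times> K))"
        using D(2) by (intro prod.cong arg_cong[where f="\<lambda>A. _ ^ card A"]) auto
      finally show ?thesis .
    qed
    moreover have "(\<lambda>\<omega>. v ^ card (offdiag (P \<omega>) \<inter> (D \<inter> s i -` {v}) \<inter> K \<times> K)) \<in> borel_measurable G" for v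
    proof -
      have "s i -` {v} \<in> sets (borel \<Otimes>\<^sub>M borel)"
        using simple_functionD(2)[OF s(1), of i "{v}"] by (simp add: space_pair_measure)
      then have "(\<lambda>\<omega>. real (card (offdiag (P \<omega>) \<inter> (D \<inter> s i -` {v}) \<inter> K \<times> K))) \<in> borel_measurable G"
        using measurable_card_offdiag_if_void_measurable[of G P K, OF lf void K] D by auto
      then have "(\<lambda>\<omega>. real (card (offdiag (P \<omega>) \<inter> (D \<inter> s i -` {v}) \<inter> K \<times> K))) -` {real k} \<inter> space G \<in> sets G" for k
        by (rule measurable_sets) simp
      then have "(\<lambda>\<omega>. card (offdiag (P \<omega>) \<inter> (D \<inter> s i -` {v}) \<inter> K \<times> K)) \<in> measurable G (count_space UNIV)"
        by (simp add: measurable_count_space_eq2_countable vimage_def)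
      then show ?thesis
        by (rule measurable_compose) simp
    qed
    ultimately show "(\<lambda>\<omega>. \<Prod>z\<in>offdiag (P \<omega>) \<inter> D. s i z) \<in> borel_measurable G"
      by (subst measurable_cong) (auto intro!: borel_measurable_prod)
  qed
qed

section \<open>Edges conditionally on the vertices\<close>

lemma locally_finite_points: "counting_measure \<mu> \<Longrightarrow> locally_finite_set (points \<mu>)"
  by (simp add: locally_finite_set_def finite_points_bounded)

definition no_edge_in :: "'a graph \<Rightarrow> ('a \<times> 'a) set \<Rightarrow> bool" where
  "no_edge_in G D \<longleftrightarrow> (\<forall>(x, y)\<in>D. {x, y} \<notin> edges G)"

locale random_connection = prob_space M for M :: "'w measure" +
  fixes \<Lambda> :: "'a::polish_space measure"
    and \<phi> :: "'a \<Rightarrow> 'a \<Rightarrow> real"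
    and \<eta> :: "'w \<Rightarrow> 'a measure"
    and \<xi> :: "'w \<Rightarrow> 'a graph"
  assumes intensity: "locally_finite_measure \<Lambda>"
    and connection: "connection_function \<Lambda> \<phi>"
    and poisson: "poisson_process M \<Lambda> \<eta>"
    and rcm: "random_connection_model M \<phi> \<eta> \<xi>"
begin

abbreviation "P \<omega> \<equiv> points (\<eta> \<omega>)"
abbreviation "void_event C \<equiv> {\<omega> \<in> space M. P \<omega> \<inter> C = {}}"
abbreviation "no_edge_event D \<equiv> {\<omega> \<in> space M. no_edge_in (\<xi> \<omega>) D}"

lemma \<eta>_measurable: "\<eta> \<in> measurable M counting_measure_algebra"
  using poisson by (simp add: poisson_process_def point_process_def)

lemma counting_measure_\<eta>: "\<omega> \<in> space M \<Longrightarrow> counting_measure (\<eta> \<omega>)"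
  using measurable_space[OF \<eta>_measurable] by (simp add: space_counting_measure_algebra)

lemma locally_finite_P: "\<omega> \<in> space M \<Longrightarrow> locally_finite_set (P \<omega>)"
  by (simp add: locally_finite_points counting_measure_\<eta>)

lemma subalgebra_sigma_generated: "subalgebra M (sigma_generated M \<eta>)"
proof -
  have "\<eta> \<in> space M \<rightarrow> space counting_measure_algebra"
    using measurable_space[OF \<eta>_measurable] by auto
  then show ?thesis
    using \<eta>_measurable unfolding sigma_generated_def subalgebra_def
    by (auto simp: sets_vimage_algebra2 dest: measurable_sets)
qed

lemma void_event_eq:
  assumes "C \<in> sets borel"
  shows "void_event C = (\<lambda>\<omega>. emeasure (\<eta> \<omega>) C) -` {0} \<inter> space M"
  using emeasure_eq_0_iff_no_points[OF counting_measure_\<eta> assms] by auto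

lemma void_event_measurable:
  assumes "C \<in> sets borel"
  shows "void_event C \<in> sets (sigma_generated M \<eta>)"
proof -
  have "\<eta> \<in> measurable (sigma_generated M \<eta>) counting_measure_algebra"
    unfolding sigma_generated_def using \<eta>_measurable
    by (intro measurable_vimage_algebra1) (auto dest: measurable_space)
  then have "(\<lambda>\<omega>. emeasure (\<eta> \<omega>) C) \<in> borel_measurable (sigma_generated M \<eta>)"
    using measurable_emeasure_counting_measure_algebra[OF assms] by (rule measurable_compose)
  then have "(\<lambda>\<omega>. emeasure (\<eta> \<omega>) C) -` {0} \<inter> space (sigma_generated M \<eta>) \<in> sets (sigma_generated M \<eta>)"
    by (rule measurable_sets) simp
  then show ?thesis
    unfolding void_event_eq[OF assms] by (simp add: sigma_generated_def)
qed

lemma void_event_in_events: "C \<in> sets borel \<Longrightarrow> void_event C \<in> events"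
  using void_event_measurable subalgebra_sigma_generated by (auto simp: subalgebra_def)

lemma prob_void_event_pos:
  assumes "B \<in> sets borel" "bounded B"
  shows "0 < prob (void_event B)"
proof -
  have "emeasure \<Lambda> B \<noteq> \<infinity>"
    using intensity assms by (auto simp: locally_finite_measure_def)
  moreover have "poisson_distributed M (\<lambda>\<omega>. emeasure (\<eta> \<omega>) B) (emeasure \<Lambda> B)"
    using poisson assms by (auto simp: poisson_process_def)
  ultimately have "prob {\<omega> \<in> space M. emeasure (\<eta> \<omega>) B = of_nat 0} =
      enn2real (emeasure \<Lambda> B) ^ 0 / fact 0 * exp (- enn2real (emeasure \<Lambda> B))"
    unfolding poisson_distributed_def by presburger
  moreover have "{\<omega> \<in> space M. emeasure (\<eta> \<omega>) B = of_nat 0} = void_event B"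
    unfolding void_event_eq[OF assms(1)] by auto
  ultimately show ?thesis by simp
qed

lemma prob_void_event_Int:
  assumes "B \<in> sets borel" "C \<in> sets borel" "B \<inter> C = {}"
  shows "prob (void_event C \<inter> void_event B) = prob (void_event C) * prob (void_event B)"
proof -
  define A where "A i = (if i = 0 then C else B)" for i :: nat
  have "\<forall>(m::nat) B. B ` {..<m} \<subseteq> sets borel \<longrightarrow> disjoint_family_on B {..<m} \<longrightarrow>
        indep_vars (\<lambda>_. borel) (\<lambda>i \<omega>. emeasure (\<eta> \<omega>) (B i)) {..<m}"
    using poisson unfolding poisson_process_def by blast
  moreover have "A ` {..<2} \<subseteq> sets borel" "disjoint_family_on A {..<2}"
    using assms by (auto simp: A_def disjoint_family_on_def)
  ultimately have indep: "indep_vars (\<lambda>_. borel) (\<lambda>i \<omega>. emeasure (\<eta> \<omega>) (A i)) {..<2}"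
    by blast
  have two: "{..<2::nat} = {0, 1}"
    by auto
  have "prob (\<Inter>i\<in>{..<2}. (\<lambda>\<omega>. emeasure (\<eta> \<omega>) (A i)) -` {0} \<inter> space M) =
      (\<Prod>i\<in>{..<2}. prob ((\<lambda>\<omega>. emeasure (\<eta> \<omega>) (A i)) -` {0} \<inter> space M))"
    by (rule indep_varsD_finite[OF indep]) (auto simp: two)
  then show ?thesis
    unfolding two void_event_eq[OF assms(1)] void_event_eq[OF assms(2)] by (simp add: A_def)
qed

text \<open>
  Number the vertices. For finitely many pairs of indices the probability that no edge is present
  follows by expanding the product of the factors \<open>1 - indicator\<close>, which reduces it to the
  probabilities that all edges of a given finite set are present; the indicators that a numbered
  pair lies in \<open>D\<close> depend on \<open>\<eta>\<close> only. As \<open>D\<close> is bounded it contains finitely many pairs of points,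
  so the products are eventually constant as more and more indices are taken into account. The
  product over ordered pairs of distinct points contains each edge twice, hence the square root.
\<close>

lemma
  assumes D: "D \<in> sets (borel \<Otimes>\<^sub>M borel)" "sym D" "D \<subseteq> K \<times> K" "bounded K"
  shows no_edge_event_in_events: "no_edge_event D \<in> events"
    and prob_no_edge_event_Int: "\<And>G. G \<in> sets (sigma_generated M \<eta>) \<Longrightarrow>
      prob (G \<inter> no_edge_event D) =
      expectation (\<lambda>\<omega>. indicator G \<omega> * sqrt (\<Prod>(x, y)\<in>offdiag (P \<omega>) \<inter> D. 1 - \<phi> x y))"
proof -
  let ?F = "sigma_generated M \<eta>"
  have space_F [simp]: "space ?F = space M"
    by (simp add: sigma_generated_def)
  interpret finite_measure_subalgebra M ?F
    using subalgebra_sigma_generated by unfold_locales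
  have simple: "\<And>\<omega>. \<omega> \<in> space M \<Longrightarrow> simple_graph (\<xi> \<omega>)" "\<And>\<omega>. \<omega> \<in> space M \<Longrightarrow> verts (\<xi> \<omega>) = P \<omega>"
    using rcm by (auto simp: random_connection_model_def)
  have \<phi>: "case_prod \<phi> \<in> borel_measurable (borel \<Otimes>\<^sub>M borel)" "\<And>x y. 0 \<le> \<phi> x y" "\<And>x y. \<phi> x y \<le> 1"
      "\<And>x y. \<phi> x y = \<phi> y x"
    using connection unfolding connection_function_def by blast+
  obtain \<kappa> X where enum: "enumerates_points M \<eta> \<kappa> X"
    and edge: "\<And>m n. m < n \<Longrightarrow> edge_event M \<xi> \<kappa> X m n \<in> sets M"
    and cond: "\<And>T. finite T \<Longrightarrow> T \<subseteq> {(m, n). m < n} \<Longrightarrow>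
         (AE \<omega> in M.
            real_cond_exp M ?F (\<lambda>\<omega>'. \<Prod>(m, n)\<in>T. indicator (edge_event M \<xi> \<kappa> X m n) \<omega>') \<omega> =
            (\<Prod>(m, n)\<in>T. if enat n < \<kappa> \<omega> then \<phi> (X m \<omega>) (X n \<omega>) else 0))"
    using rcm unfolding random_connection_model_def by blast
  have [measurable]: "\<kappa> \<in> measurable ?F (count_space UNIV)" "\<And>n. X n \<in> borel_measurable ?F"
    and bij: "\<And>\<omega>. \<omega> \<in> space M \<Longrightarrow> bij_betw (\<lambda>n. X n \<omega>) {n. enat n < \<kappa> \<omega>} (P \<omega>)"
    using enum by (auto simp: enumerates_points_def)
  \<comment> \<open>\<open>I p\<close> indicates that the pair \<open>p\<close> of indices is an edge, \<open>q p\<close> is its conditional probability, and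
    \<open>a p\<close> indicates that both vertices exist and form a pair in \<open>D\<close>.\<close>
  define a :: "nat \<times> nat \<Rightarrow> 'w \<Rightarrow> real" where
    "a p = indicator {\<omega> \<in> space M. enat (snd p) < \<kappa> \<omega> \<and> (X (fst p) \<omega>, X (snd p) \<omega>) \<in> D}" for p
  define I :: "nat \<times> nat \<Rightarrow> 'w \<Rightarrow> real" where
    "I p = indicator (edge_event M \<xi> \<kappa> X (fst p) (snd p))" for p
  define q where
    "q p \<omega> = (if enat (snd p) < \<kappa> \<omega> then \<phi> (X (fst p) \<omega>) (X (snd p) \<omega>) else 0)" for p \<omega>
  define pairs where "pairs L = {p. fst p < snd p \<and> snd p < L}" for L :: nat
  define J where "J \<omega> = {p. fst p < snd p \<and> enat (snd p) < \<kappa> \<omega> \<and> (X (fst p) \<omega>, X (snd p) \<omega>) \<in> D}" for \<omega>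
  have fin_pairs: "finite (pairs L)" for L
    by (rule finite_subset[of _ "{..<L} \<times> {..<L}"]) (auto simp: pairs_def)
  have a_F: "a p \<in> borel_measurable ?F" for p
  proof -
    have "{\<omega> \<in> space ?F. enat (snd p) < \<kappa> \<omega> \<and> (X (fst p) \<omega>, X (snd p) \<omega>) \<in> D} \<in> sets ?F"
      using D(1) by measurable
    then show ?thesis
      unfolding a_def by (intro borel_measurable_indicator) simp
  qed
  have I_M: "fst p < snd p \<Longrightarrow> I p \<in> borel_measurable M" for p
    unfolding I_def by (intro borel_measurable_indicator edge)
  have q_F: "q p \<in> borel_measurable ?F" for p
  proof -
    have "(\<lambda>\<omega>. case_prod \<phi> (X (fst p) \<omega>, X (snd p) \<omega>)) \<in> borel_measurable ?F"
      by (rule measurable_compose[OF _ \<phi>(1)]) measurable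
    then show ?thesis
      unfolding q_def by simp
  qed
  have toM: "f \<in> borel_measurable M" if "f \<in> borel_measurable ?F" for f :: "'w \<Rightarrow> real"
    using measurable_from_subalg[OF subalg that] .
  have a01: "0 \<le> a p \<omega>" "a p \<omega> \<le> 1" and I01: "0 \<le> I p \<omega>" "I p \<omega> \<le> 1"
    and q01: "0 \<le> q p \<omega>" "q p \<omega> \<le> 1" for p \<omega>
    using \<phi> by (auto simp: a_def I_def q_def indicator_def)

  have finite_step: "expectation (\<lambda>\<omega>. indicator G \<omega> * (\<Prod>p\<in>pairs L. 1 - a p \<omega> * I p \<omega>)) =
      expectation (\<lambda>\<omega>. indicator G \<omega> * (\<Prod>p\<in>pairs L. 1 - a p \<omega> * q p \<omega>))"
    if G: "G \<in> sets ?F" for G L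
  proof -
    define f where "f T \<omega> = indicator G \<omega> * (-1) ^ card T * (\<Prod>p\<in>T. a p \<omega>)" for T \<omega>
    have f_F: "f T \<in> borel_measurable ?F" for T
      unfolding f_def using a_F G by (intro borel_measurable_times borel_measurable_prod) auto
    have prod_bound: "\<bar>\<Prod>p\<in>T. g p \<omega>\<bar> \<le> 1" if "\<And>p. 0 \<le> g p \<omega>" "\<And>p. g p \<omega> \<le> 1"
      for T and g :: "nat \<times> nat \<Rightarrow> 'w \<Rightarrow> real" and \<omega>
      using that by (auto simp: abs_prod intro!: prod_le_1)
    have f_bound: "\<bar>f T \<omega>\<bar> \<le> 1" for T \<omega>
      unfolding f_def abs_mult
      by (intro mult_le_one prod_bound a01) (auto simp: indicator_def power_abs)
    have expand: "indicator G \<omega> * (\<Prod>p\<in>pairs L. 1 - a p \<omega> * g p \<omega>) =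
        (\<Sum>T\<in>Pow (pairs L). f T \<omega> * (\<Prod>p\<in>T. g p \<omega>))" for g \<omega>
      unfolding prod_diff_conv_sum[OF fin_pairs] f_def
      by (simp add: sum_distrib_left prod.distrib mult_ac)
    have int: "integrable M (\<lambda>\<omega>. f T \<omega> * (\<Prod>p\<in>T. g p \<omega>))"
      if "\<And>p. p \<in> T \<Longrightarrow> g p \<in> borel_measurable M" "\<And>p \<omega>. 0 \<le> g p \<omega>" "\<And>p \<omega>. g p \<omega> \<le> 1"
      for T and g :: "nat \<times> nat \<Rightarrow> 'w \<Rightarrow> real"
    proof (rule integrable_const_bound[of _ 1])
      show "AE \<omega> in M. norm (f T \<omega> * (\<Prod>p\<in>T. g p \<omega>)) \<le> 1"
        using that(2,3) by (intro AE_I2) (simp only: real_norm_def abs_mult, intro mult_le_one f_bound prod_bound, auto)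
      show "(\<lambda>\<omega>. f T \<omega> * (\<Prod>p\<in>T. g p \<omega>)) \<in> borel_measurable M"
        using toM[OF f_F] that(1) by (intro borel_measurable_times borel_measurable_prod) auto
    qed
    have termwise: "expectation (\<lambda>\<omega>. f T \<omega> * (\<Prod>p\<in>T. I p \<omega>)) = expectation (\<lambda>\<omega>. f T \<omega> * (\<Prod>p\<in>T. q p \<omega>))"
      if T: "T \<in> Pow (pairs L)" for T
    proof -
      have T': "finite T" "T \<subseteq> {(m, n). m < n}"
        using T fin_pairs[of L] by (auto simp: pairs_def intro: finite_subset)
      have IM: "\<And>p. p \<in> T \<Longrightarrow> I p \<in> borel_measurable M"
        using T by (auto simp: pairs_def intro: I_M)
      have "expectation (\<lambda>\<omega>. f T \<omega> * (\<Prod>p\<in>T. I p \<omega>)) =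
          expectation (\<lambda>\<omega>. f T \<omega> * real_cond_exp M ?F (\<lambda>\<omega>. \<Prod>p\<in>T. I p \<omega>) \<omega>)"
        using IM I01 f_F by (intro real_cond_exp_intg(2)[symmetric] int borel_measurable_prod) auto
      also have "\<dots> = expectation (\<lambda>\<omega>. f T \<omega> * (\<Prod>p\<in>T. q p \<omega>))"
      proof (rule integral_cong_AE)
        show "(\<lambda>\<omega>. f T \<omega> * real_cond_exp M ?F (\<lambda>\<omega>. \<Prod>p\<in>T. I p \<omega>) \<omega>) \<in> borel_measurable M"
          by (intro borel_measurable_times toM f_F borel_measurable_cond_exp)
        show "(\<lambda>\<omega>. f T \<omega> * (\<Prod>p\<in>T. q p \<omega>)) \<in> borel_measurable M"
          by (intro borel_measurable_times borel_measurable_prod toM f_F q_F)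
        show "AE \<omega> in M. f T \<omega> * real_cond_exp M ?F (\<lambda>\<omega>. \<Prod>p\<in>T. I p \<omega>) \<omega> = f T \<omega> * (\<Prod>p\<in>T. q p \<omega>)"
          using cond[OF T'] by eventually_elim (simp add: I_def q_def case_prod_unfold)
      qed
      finally show ?thesis .
    qed
    have "expectation (\<lambda>\<omega>. indicator G \<omega> * (\<Prod>p\<in>pairs L. 1 - a p \<omega> * I p \<omega>)) =
        (\<Sum>T\<in>Pow (pairs L). expectation (\<lambda>\<omega>. f T \<omega> * (\<Prod>p\<in>T. I p \<omega>)))"
      unfolding expand using I01 by (intro Bochner_Integration.integral_sum int) (auto simp: pairs_def intro!: I_M)
    also have "\<dots> = (\<Sum>T\<in>Pow (pairs L). expectation (\<lambda>\<omega>. f T \<omega> * (\<Prod>p\<in>T. q p \<omega>)))"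
      by (intro sum.cong refl termwise)
    also have "\<dots> = expectation (\<lambda>\<omega>. indicator G \<omega> * (\<Prod>p\<in>pairs L. 1 - a p \<omega> * q p \<omega>))"
      unfolding expand using q01
      by (intro Bochner_Integration.integral_sum[symmetric] int) (auto intro!: toM q_F)
    finally show ?thesis .
  qed

  have inj: "inj_on (\<lambda>n. X n \<omega>) {n. enat n < \<kappa> \<omega>}" and img: "(\<lambda>n. X n \<omega>) ` {n. enat n < \<kappa> \<omega>} = P \<omega>"
    if "\<omega> \<in> space M" for \<omega>
    using bij[OF that] by (auto simp: bij_betw_def)
  \<comment> \<open>\<open>J \<omega>\<close> consists of the increasing pairs of indices that matter for \<open>D\<close>; adding the decreasing ones
    gives the set \<open>J2 \<omega>\<close>, which the numbering maps bijectively to the pairs of distinct points in \<open>D\<close>.\<close>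
  define J2 where "J2 \<omega> = {p. fst p \<noteq> snd p \<and> enat (fst p) < \<kappa> \<omega> \<and> enat (snd p) < \<kappa> \<omega> \<and>
      (X (fst p) \<omega>, X (snd p) \<omega>) \<in> D}" for \<omega>
  have J2_bij: "bij_betw (\<lambda>p. (X (fst p) \<omega>, X (snd p) \<omega>)) (J2 \<omega>) (offdiag (P \<omega>) \<inter> D)"
    if \<omega>: "\<omega> \<in> space M" for \<omega>
  proof (rule bij_betw_imageI)
    show "inj_on (\<lambda>p. (X (fst p) \<omega>, X (snd p) \<omega>)) (J2 \<omega>)"
      using inj_onD[OF inj[OF \<omega>]] by (intro inj_onI) (auto simp: J2_def)
    have "fst p \<noteq> snd p \<Longrightarrow> enat (fst p) < \<kappa> \<omega> \<Longrightarrow> enat (snd p) < \<kappa> \<omega> \<Longrightarrow> X (fst p) \<omega> \<noteq> X (snd p) \<omega>" for p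
      using inj_onD[OF inj[OF \<omega>], of "fst p" "snd p"] by auto
    then have "(\<lambda>p. (X (fst p) \<omega>, X (snd p) \<omega>)) ` J2 \<omega> \<subseteq> offdiag (P \<omega>) \<inter> D"
      by (auto simp: J2_def offdiag_def simp flip: img[OF \<omega>])
    moreover have "z \<in> (\<lambda>p. (X (fst p) \<omega>, X (snd p) \<omega>)) ` J2 \<omega>" if z: "z \<in> offdiag (P \<omega>) \<inter> D" for z
    proof -
      obtain m n where "enat m < \<kappa> \<omega>" "enat n < \<kappa> \<omega>" "z = (X m \<omega>, X n \<omega>)"
        using z by (auto simp: offdiag_def simp flip: img[OF \<omega>])
      moreover from this z have "(m, n) \<in> J2 \<omega>"
        by (auto simp: J2_def offdiag_def)
      ultimately show ?thesis
        by (intro image_eqI[of _ _ "(m, n)"]) auto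
    qed
    ultimately show "(\<lambda>p. (X (fst p) \<omega>, X (snd p) \<omega>)) ` J2 \<omega> = offdiag (P \<omega>) \<inter> D"
      by blast
  qed
  have J2_split: "J2 \<omega> = J \<omega> \<union> prod.swap ` J \<omega>" "J \<omega> \<inter> prod.swap ` J \<omega> = {}" for \<omega>
  proof -
    have less: "enat m < \<kappa> \<omega>" if "m < n" "enat n < \<kappa> \<omega>" for m n
      using that by (meson enat_ord_simps(2) order_less_trans)
    have "p \<in> J2 \<omega> \<longleftrightarrow> p \<in> J \<omega> \<union> prod.swap ` J \<omega>" for p
    proof (cases p)
      case (Pair m n)
      have "(n, m) \<in> J \<omega> \<longleftrightarrow> p \<in> prod.swap ` J \<omega>"
        unfolding Pair by (force simp: image_iff)
      moreover have "(X n \<omega>, X m \<omega>) \<in> D \<longleftrightarrow> (X m \<omega>, X n \<omega>) \<in> D"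
        using symD[OF D(2)] by blast
      ultimately show ?thesis
        using less[of m n] less[of n m] unfolding Pair by (auto simp: J2_def J_def nat_neq_iff)
    qed
    then show "J2 \<omega> = J \<omega> \<union> prod.swap ` J \<omega>" by blast
    show "J \<omega> \<inter> prod.swap ` J \<omega> = {}" by (auto simp: J_def)
  qed
  have fin_J: "finite (J \<omega>)" if \<omega>: "\<omega> \<in> space M" for \<omega>
  proof -
    have "finite (offdiag (P \<omega>) \<inter> D)"
      using locally_finite_P[OF \<omega>] D by (intro finite_offdiag_Int[of _ K]) (auto simp: locally_finite_set_def)
    then have "finite (J2 \<omega>)"
      using bij_betw_finite[OF J2_bij[OF \<omega>]] by simp
    then show ?thesis
      unfolding J2_split by simp
  qed
  have prod_eq: "sqrt (\<Prod>(x, y)\<in>offdiag (P \<omega>) \<inter> D. 1 - \<phi> x y) = (\<Prod>p\<in>J \<omega>. 1 - q p \<omega>)"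
    if \<omega>: "\<omega> \<in> space M" for \<omega>
  proof -
    let ?g = "\<lambda>p. 1 - \<phi> (X (fst p) \<omega>) (X (snd p) \<omega>)"
    have "(\<Prod>(x, y)\<in>offdiag (P \<omega>) \<inter> D. 1 - \<phi> x y) = (\<Prod>p\<in>J2 \<omega>. ?g p)"
      using prod.reindex_bij_betw[OF J2_bij[OF \<omega>], of "\<lambda>(x, y). 1 - \<phi> x y"] by simp
    also have "\<dots> = (\<Prod>p\<in>J \<omega>. ?g p) * (\<Prod>p\<in>prod.swap ` J \<omega>. ?g p)"
      unfolding J2_split using fin_J[OF \<omega>] J2_split(2) by (intro prod.union_disjoint) auto
    also have "(\<Prod>p\<in>prod.swap ` J \<omega>. ?g p) = (\<Prod>p\<in>J \<omega>. ?g p)"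
      by (subst prod.reindex) (auto simp: \<phi>(4) intro!: prod.cong)
    also have "(\<Prod>p\<in>J \<omega>. ?g p) = (\<Prod>p\<in>J \<omega>. 1 - q p \<omega>)"
      by (intro prod.cong) (auto simp: J_def q_def)
    finally show ?thesis
      using q01 by (simp add: prod_nonneg)
  qed
  have no_edge_iff: "no_edge_in (\<xi> \<omega>) D \<longleftrightarrow> (\<forall>p\<in>J \<omega>. I p \<omega> = 0)" if \<omega>: "\<omega> \<in> space M" for \<omega>
  proof
    have less: "enat m < \<kappa> \<omega>" if "m < n" "enat n < \<kappa> \<omega>" for m n
      using that by (meson enat_ord_simps(2) order_less_trans)
    have I_iff: "I p \<omega> = 0 \<longleftrightarrow> {X (fst p) \<omega>, X (snd p) \<omega>} \<notin> edges (\<xi> \<omega>)" if "p \<in> J \<omega>" for p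
      using that \<omega> less by (auto simp: I_def J_def edge_event_def indicator_def)
    show "\<forall>p\<in>J \<omega>. I p \<omega> = 0" if "no_edge_in (\<xi> \<omega>) D"
      using that I_iff by (auto simp: no_edge_in_def J_def)
    assume none: "\<forall>p\<in>J \<omega>. I p \<omega> = 0"
    show "no_edge_in (\<xi> \<omega>) D"
      unfolding no_edge_in_def
    proof (clarify)
      fix x y assume xy: "(x, y) \<in> D" "{x, y} \<in> edges (\<xi> \<omega>)"
      then have "x \<in> P \<omega>" "y \<in> P \<omega>" "x \<noteq> y"
        using simple[OF \<omega>] unfolding simple_graph_def by (auto simp: doubleton_eq_iff)
      then have "(x, y) \<in> offdiag (P \<omega>) \<inter> D"
        using xy by (auto simp: offdiag_def)
      then obtain p where p: "p \<in> J2 \<omega>" "X (fst p) \<omega> = x" "X (snd p) \<omega> = y"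
        using bij_betw_imp_surj_on[OF J2_bij[OF \<omega>]] by force
      then consider "p \<in> J \<omega>" | "prod.swap p \<in> J \<omega>"
        unfolding J2_split by force
      then show False
      proof cases
        case 1
        then show ?thesis
          using none I_iff[OF 1] p xy by auto
      next
        case 2
        then show ?thesis
          using none I_iff[OF 2] p xy by (auto simp: insert_commute)
      qed
    qed
  qed
  have lim: "(\<lambda>L. \<Prod>p\<in>pairs L. 1 - a p \<omega> * g p) \<longlonglongrightarrow> (\<Prod>p\<in>J \<omega>. 1 - g p)"
    if \<omega>: "\<omega> \<in> space M" for \<omega> and g :: "nat \<times> nat \<Rightarrow> real"
  proof -
    have "finite (snd ` J \<omega>)"
      using fin_J[OF \<omega>] by simp
    then obtain N where N: "\<And>p. p \<in> J \<omega> \<Longrightarrow> snd p < N"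
      by (auto simp: finite_nat_set_iff_bounded)
    have "(\<Prod>p\<in>pairs L. 1 - a p \<omega> * g p) = (\<Prod>p\<in>J \<omega>. 1 - g p)" if "N \<le> L" for L
    proof (rule prod.mono_neutral_cong_right[OF fin_pairs])
      have "fst p < snd p \<and> snd p < L" if "p \<in> J \<omega>" for p
        using N[OF that] \<open>N \<le> L\<close> that by (simp add: J_def)
      then show "J \<omega> \<subseteq> pairs L"
        by (auto simp: pairs_def)
      have "a p \<omega> = 0" if "p \<in> pairs L - J \<omega>" for p
        using that by (auto simp: a_def pairs_def J_def indicator_def)
      then show "\<forall>p\<in>pairs L - J \<omega>. 1 - a p \<omega> * g p = 1"
        by simp
      have "a p \<omega> = 1" if "p \<in> J \<omega>" for p
        using that \<omega> by (auto simp: a_def J_def indicator_def)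
      then show "1 - a p \<omega> * g p = 1 - g p" if "p \<in> J \<omega>" for p
        using that by simp
    qed
    then show ?thesis
      by (intro tendsto_eventually eventually_sequentiallyI[of N]) auto
  qed
  have limI: "(\<lambda>L. \<Prod>p\<in>pairs L. 1 - a p \<omega> * I p \<omega>) \<longlonglongrightarrow> indicator (no_edge_event D) \<omega>" if "\<omega> \<in> space M" for \<omega>
  proof -
    have "(\<Prod>p\<in>J \<omega>. 1 - I p \<omega>) = indicator (no_edge_event D) \<omega>"
      using no_edge_iff[OF that] fin_J[OF that] that
      by (auto simp: indicator_def I_def split: if_splits)
    then show ?thesis
      using lim[OF that, of "\<lambda>p. I p \<omega>"] by simp
  qed
  have meas: "(\<lambda>\<omega>. \<Prod>p\<in>pairs L. 1 - a p \<omega> * I p \<omega>) \<in> borel_measurable M" for L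
    by (intro borel_measurable_prod borel_measurable_diff borel_measurable_times toM[OF a_F] I_M) (auto simp: pairs_def)
  have "(indicator (no_edge_event D) :: 'w \<Rightarrow> real) \<in> borel_measurable M"
    by (rule borel_measurable_LIMSEQ_real[OF limI meas])
  then have "no_edge_event D \<inter> space M \<in> events"
    by (simp add: borel_measurable_indicator_iff)
  moreover have "no_edge_event D \<inter> space M = no_edge_event D"
    by blast
  ultimately show ev: "no_edge_event D \<in> events"
    by metis
  fix G assume G: "G \<in> sets ?F"
  then have G': "G \<in> events"
    using subalg by (auto simp: subalgebra_def)
  have bound: "\<bar>indicator G \<omega> * (\<Prod>p\<in>pairs L. 1 - a p \<omega> * g p \<omega>)\<bar> \<le> 1"
    if "\<And>p. 0 \<le> g p \<omega>" "\<And>p. g p \<omega> \<le> 1" for L \<omega> and g :: "nat \<times> nat \<Rightarrow> 'w \<Rightarrow> real"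
    unfolding abs_mult
  proof (rule mult_le_one)
    have "0 \<le> 1 - a p \<omega> * g p \<omega>" "1 - a p \<omega> * g p \<omega> \<le> 1" for p
      using a01[of p \<omega>] that[of p] by (auto intro: mult_le_one)
    then show "\<bar>\<Prod>p\<in>pairs L. 1 - a p \<omega> * g p \<omega>\<bar> \<le> 1"
      by (auto simp: abs_prod intro!: prod_le_1)
  qed (auto simp: indicator_def)
  have "(\<lambda>L. expectation (\<lambda>\<omega>. indicator G \<omega> * (\<Prod>p\<in>pairs L. 1 - a p \<omega> * I p \<omega>))) \<longlonglongrightarrow>
      expectation (\<lambda>\<omega>. indicator G \<omega> * indicator (no_edge_event D) \<omega>)"
  proof (rule integral_dominated_convergence[where w="\<lambda>_. 1"])
    show "AE \<omega> in M. (\<lambda>L. indicator G \<omega> * (\<Prod>p\<in>pairs L. 1 - a p \<omega> * I p \<omega>)) \<longlonglongrightarrow>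
        indicator G \<omega> * indicator (no_edge_event D) \<omega>"
      by (intro AE_I2 tendsto_mult tendsto_const limI)
    show "AE \<omega> in M. norm (indicator G \<omega> * (\<Prod>p\<in>pairs L. 1 - a p \<omega> * I p \<omega>)) \<le> 1" for L
      using bound I01 by (intro AE_I2) simp
  qed (use G' ev meas in auto)
  moreover have "(\<lambda>L. expectation (\<lambda>\<omega>. indicator G \<omega> * (\<Prod>p\<in>pairs L. 1 - a p \<omega> * q p \<omega>))) \<longlonglongrightarrow>
      expectation (\<lambda>\<omega>. indicator G \<omega> * sqrt (\<Prod>(x, y)\<in>offdiag (P \<omega>) \<inter> D. 1 - \<phi> x y))"
  proof (rule integral_dominated_convergence[where w="\<lambda>_. 1"])
    have meas: "(\<lambda>\<omega>. \<Prod>p\<in>pairs L. 1 - a p \<omega> * q p \<omega>) \<in> borel_measurable M" for L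
      by (intro borel_measurable_prod borel_measurable_diff borel_measurable_times toM[OF a_F] toM[OF q_F]) auto
    then show "(\<lambda>\<omega>. indicator G \<omega> * (\<Prod>p\<in>pairs L. 1 - a p \<omega> * q p \<omega>)) \<in> borel_measurable M" for L
      using G' by auto
    show "(\<lambda>\<omega>. indicator G \<omega> * sqrt (\<Prod>(x, y)\<in>offdiag (P \<omega>) \<inter> D. 1 - \<phi> x y)) \<in> borel_measurable M"
    proof (rule borel_measurable_times)
      have "(\<lambda>\<omega>. \<Prod>p\<in>J \<omega>. 1 - q p \<omega>) \<in> borel_measurable M"
        by (rule borel_measurable_LIMSEQ_real[OF lim meas])
      then show "(\<lambda>\<omega>. sqrt (\<Prod>(x, y)\<in>offdiag (P \<omega>) \<inter> D. 1 - \<phi> x y)) \<in> borel_measurable M"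
        by (rule measurable_cong[THEN iffD2, rotated]) (rule prod_eq)
    qed (use G' in auto)
    show "AE \<omega> in M. (\<lambda>L. indicator G \<omega> * (\<Prod>p\<in>pairs L. 1 - a p \<omega> * q p \<omega>)) \<longlonglongrightarrow>
        indicator G \<omega> * sqrt (\<Prod>(x, y)\<in>offdiag (P \<omega>) \<inter> D. 1 - \<phi> x y)"
      by (intro AE_I2 tendsto_mult tendsto_const) (simp add: prod_eq lim)
    show "AE \<omega> in M. norm (indicator G \<omega> * (\<Prod>p\<in>pairs L. 1 - a p \<omega> * q p \<omega>)) \<le> 1" for L
      using bound q01 by (intro AE_I2) simp
  qed auto
  ultimately have "expectation (\<lambda>\<omega>. indicator G \<omega> * indicator (no_edge_event D) \<omega>) =
      expectation (\<lambda>\<omega>. indicator G \<omega> * sqrt (\<Prod>(x, y)\<in>offdiag (P \<omega>) \<inter> D. 1 - \<phi> x y))"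
    unfolding finite_step[OF G] by (rule LIMSEQ_unique)
  moreover have "expectation (\<lambda>\<omega>. indicator G \<omega> * indicator (no_edge_event D) \<omega>) = prob (G \<inter> no_edge_event D)"
    using G' ev by (simp flip: indicator_inter_arith)
  ultimately show "prob (G \<inter> no_edge_event D) =
      expectation (\<lambda>\<omega>. indicator G \<omega> * sqrt (\<Prod>(x, y)\<in>offdiag (P \<omega>) \<inter> D. 1 - \<phi> x y))"
    by simp
qed

end

section \<open>Infinite clusters seen through a countable base\<close>

definition isolates :: "'a graph \<Rightarrow> 'a set \<Rightarrow> bool" where
  "isolates G U \<longleftrightarrow> card (verts G \<inter> U) = 1"

text \<open>
  Indices of base sets that isolate the same vertex count as adjacent. Without this clause the
  different indices that represent one isolated vertex would be unrelated.
\<close>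

definition base_adjacency :: "'a graph \<Rightarrow> (nat \<Rightarrow> 'a set) \<Rightarrow> (nat \<times> nat) set" where
  "base_adjacency G b =
     {(i, j). isolates G (b i) \<and> isolates G (b j) \<and>
        (verts G \<inter> (b i \<inter> b j) \<noteq> {} \<or> \<not> no_edge_in G (b i \<times> b j))}"

lemma isolatesE:
  assumes "isolates G U"
  obtains x where "verts G \<inter> U = {x}"
  using assms by (auto simp: isolates_def card_1_singleton_iff)

lemma isolatesI: "verts G \<inter> U = {x} \<Longrightarrow> isolates G U"
  by (simp add: isolates_def)

lemma base_adjacency_rtrancl_isolates:
  "(i, j) \<in> (base_adjacency G b)\<^sup>* \<Longrightarrow> isolates G (b i) \<Longrightarrow> isolates G (b j)"
  by (induction rule: rtrancl_induct) (auto simp: base_adjacency_def)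

lemma edge_verts:
  assumes "simple_graph G" "{x, y} \<in> edges G"
  shows "x \<in> verts G" "y \<in> verts G"
  using assms unfolding simple_graph_def by (auto simp: doubleton_eq_iff)

lemma edge_subset_verts: "simple_graph G \<Longrightarrow> e \<in> edges G \<Longrightarrow> e \<subseteq> verts G"
  unfolding simple_graph_def by blast

lemma adjacency_rtrancl_if_base_adjacency_rtrancl:
  assumes simple: "simple_graph G"
    and "(i, j) \<in> (base_adjacency G b)\<^sup>*" "verts G \<inter> b i = {x}" "verts G \<inter> b j = {y}"
  shows "(x, y) \<in> (adjacency G)\<^sup>*"
  using assms(2-)
proof (induction arbitrary: y rule: rtrancl_induct)
  case base
  then show ?case by auto
next
  case (step j k)
  then obtain z where z: "verts G \<inter> b j = {z}"
    by (auto simp: base_adjacency_def elim: isolatesE)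
  with step have xz: "(x, z) \<in> (adjacency G)\<^sup>*"
    by auto
  from step.hyps(2) consider "verts G \<inter> (b j \<inter> b k) \<noteq> {}"
    | u v where "u \<in> b j" "v \<in> b k" "{u, v} \<in> edges G"
    by (auto simp: base_adjacency_def no_edge_in_def)
  then show ?case
  proof cases
    case 1
    then have "z = y"
      using z step.prems(2) by auto
    with xz show ?thesis by simp
  next
    case 2
    then have "u = z" "v = y"
      using edge_verts[OF simple 2(3)] z step.prems(2) by auto
    then have "(z, y) \<in> adjacency G"
      using 2 edge_verts[OF simple 2(3)] by (auto simp: adjacency_def)
    with xz show ?thesis by simp
  qed
qed

lemma base_adjacency_rtrancl_if_adjacency_rtrancl:
  assumes b: "bounded_base b" and lf: "locally_finite_set (verts G)"
    and "(x, y) \<in> (adjacency G)\<^sup>*" "verts G \<inter> b i = {x}" "verts G \<inter> b j = {y}"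
  shows "(i, j) \<in> (base_adjacency G b)\<^sup>*"
  using assms(3-)
proof (induction arbitrary: j rule: rtrancl_induct)
  case base
  then have "(i, j) \<in> base_adjacency G b"
    by (auto simp: base_adjacency_def intro: isolatesI)
  then show ?case by auto
next
  case (step y z)
  then have y: "y \<in> verts G" "{y, z} \<in> edges G"
    by (auto simp: adjacency_def)
  obtain l where l: "y \<in> b l" "verts G \<inter> b l = {y}"
    using isolating_base_set[OF b lf y(1), of UNIV] by auto
  have "(i, l) \<in> (base_adjacency G b)\<^sup>*"
    using step.IH step.prems l by auto
  moreover have "(l, j) \<in> base_adjacency G b"
  proof -
    have "z \<in> b j"
      using step.prems(2) by blast
    then have "\<not> no_edge_in G (b l \<times> b j)"
      using l(1) y(2) by (auto simp: no_edge_in_def)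
    then show ?thesis
      using l step.prems by (auto simp: base_adjacency_def intro: isolatesI)
  qed
  ultimately show ?case by auto
qed

text \<open>
  In a locally finite set infinite means unbounded, and unboundedness can be tested on countably
  many balls and base sets.
\<close>

lemma infinite_cluster_iff_base:
  fixes G :: "'a::metric_space graph"
  assumes b: "bounded_base b" and lf: "locally_finite_set (verts G)" and simple: "simple_graph G"
    and i: "verts G \<inter> b i = {x}"
  shows "infinite ((adjacency G)\<^sup>* `` {x}) \<longleftrightarrow>
    (\<forall>n::nat. \<exists>k. (i, k) \<in> (base_adjacency G b)\<^sup>* \<and> b k \<inter> ball x\<^sub>0 n = {})"
proof
  have verts: "(adjacency G)\<^sup>* `` {x} \<subseteq> verts G"
  proof
    fix y assume "y \<in> (adjacency G)\<^sup>* `` {x}"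
    then have "(x, y) \<in> (adjacency G)\<^sup>*" by simp
    then show "y \<in> verts G"
      using i by (induction rule: rtrancl_induct) (auto simp: adjacency_def)
  qed
  show "\<forall>n::nat. \<exists>k. (i, k) \<in> (base_adjacency G b)\<^sup>* \<and> b k \<inter> ball x\<^sub>0 n = {}"
    if inf: "infinite ((adjacency G)\<^sup>* `` {x})"
  proof
    fix n :: nat
    have "finite (verts G \<inter> cball x\<^sub>0 n)"
      using lf by (auto simp: locally_finite_set_def)
    then have "\<not> (adjacency G)\<^sup>* `` {x} \<subseteq> verts G \<inter> cball x\<^sub>0 n"
      using inf finite_subset by blast
    then obtain y where y: "(x, y) \<in> (adjacency G)\<^sup>*" "y \<in> verts G" "y \<in> - cball x\<^sub>0 n"
      using verts by blast
    obtain k where k: "b k \<subseteq> - cball x\<^sub>0 n" "verts G \<inter> b k = {y}"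
      using isolating_base_set[OF b lf y(2,3)] by auto
    have "(i, k) \<in> (base_adjacency G b)\<^sup>*"
      by (rule base_adjacency_rtrancl_if_adjacency_rtrancl[OF b lf y(1) i k(2)])
    moreover have "b k \<inter> ball x\<^sub>0 n = {}"
      using k(1) ball_subset_cball by blast
    ultimately show "\<exists>k. (i, k) \<in> (base_adjacency G b)\<^sup>* \<and> b k \<inter> ball x\<^sub>0 n = {}"
      by blast
  qed
  show "infinite ((adjacency G)\<^sup>* `` {x})"
    if far: "\<forall>n::nat. \<exists>k. (i, k) \<in> (base_adjacency G b)\<^sup>* \<and> b k \<inter> ball x\<^sub>0 n = {}"
  proof
    assume "finite ((adjacency G)\<^sup>* `` {x})"
    then obtain e where e: "(adjacency G)\<^sup>* `` {x} \<subseteq> ball x\<^sub>0 e"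
      using bounded_subset_ballD[OF finite_imp_bounded] by blast
    obtain n :: nat where "e < n"
      using reals_Archimedean2 by blast
    with e have n: "(adjacency G)\<^sup>* `` {x} \<subseteq> ball x\<^sub>0 n"
      by (auto dest!: subsetD)
    obtain k where k: "(i, k) \<in> (base_adjacency G b)\<^sup>*" "b k \<inter> ball x\<^sub>0 n = {}"
      using far by blast
    obtain y where y: "verts G \<inter> b k = {y}"
      using base_adjacency_rtrancl_isolates[OF k(1) isolatesI[OF i]] by (rule isolatesE)
    have "(x, y) \<in> (adjacency G)\<^sup>*"
      by (rule adjacency_rtrancl_if_base_adjacency_rtrancl[OF simple k(1) i y])
    then show False
      using n k y by blast
  qed
qed

lemma sym_adjacency_rtrancl: "(x, y) \<in> (adjacency G)\<^sup>* \<Longrightarrow> (y, x) \<in> (adjacency G)\<^sup>*"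
  by (rule symD[OF sym_rtrancl]) (auto simp: adjacency_def sym_def insert_commute)

text \<open>
  All quantifiers on the right-hand side range over natural numbers. In this form the event that
  there are two infinite clusters is measurable as soon as the
  isolation and adjacency events are.
\<close>

lemma not_at_most_one_infinite_cluster_iff_base:
  fixes G :: "'a::metric_space graph"
  assumes b: "bounded_base b" and lf: "locally_finite_set (verts G)" and simple: "simple_graph G"
  defines "R \<equiv> (base_adjacency G b)\<^sup>*"
  shows "\<not> at_most_one_infinite_cluster G \<longleftrightarrow>
    (\<exists>i j. isolates G (b i) \<and> isolates G (b j) \<and> (i, j) \<notin> R \<and>
      (\<forall>n::nat. \<exists>k. (i, k) \<in> R \<and> b k \<inter> ball x\<^sub>0 n = {}) \<and>
      (\<forall>n::nat. \<exists>k. (j, k) \<in> R \<and> b k \<inter> ball x\<^sub>0 n = {}))"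
    (is "?L \<longleftrightarrow> (\<exists>i j. ?Q i j)")
proof
  note inf_iff = infinite_cluster_iff_base[OF b lf simple, of _ _ x\<^sub>0, folded R_def]
  assume ?L
  then obtain C D where CD: "C \<in> clusters G" "D \<in> clusters G" "infinite C" "infinite D" "C \<noteq> D"
    unfolding at_most_one_infinite_cluster_def by auto
  obtain x y where xy: "x \<in> verts G" "y \<in> verts G" "C = (adjacency G)\<^sup>* `` {x}" "D = (adjacency G)\<^sup>* `` {y}"
    using CD(1,2) unfolding clusters_def by (auto elim!: quotientE)
  obtain i where i: "verts G \<inter> b i = {x}"
    using isolating_base_set[OF b lf xy(1), of UNIV] by auto
  obtain j where j: "verts G \<inter> b j = {y}"
    using isolating_base_set[OF b lf xy(2), of UNIV] by auto
  have "(i, j) \<notin> R"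
  proof
    assume "(i, j) \<in> R"
    then have "(x, y) \<in> (adjacency G)\<^sup>*"
      unfolding R_def by (rule adjacency_rtrancl_if_base_adjacency_rtrancl[OF simple _ i j])
    then have "(x, z) \<in> (adjacency G)\<^sup>* \<longleftrightarrow> (y, z) \<in> (adjacency G)\<^sup>*" for z
      using sym_adjacency_rtrancl rtrancl_trans by metis
    then have "C = D"
      unfolding xy by auto
    with CD(5) show False ..
  qed
  then have "?Q i j"
    using CD(3,4) isolatesI[OF i] isolatesI[OF j] unfolding xy inf_iff[OF i] inf_iff[OF j] by (intro conjI)
  then show "\<exists>i j. ?Q i j" by (intro exI)
next
  note inf_iff = infinite_cluster_iff_base[OF b lf simple, of _ _ x\<^sub>0, folded R_def]
  assume "\<exists>i j. ?Q i j"
  then obtain i j where ij: "?Q i j" by blast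
  obtain x where x: "verts G \<inter> b i = {x}"
    using ij by (auto elim: isolatesE)
  obtain y where y: "verts G \<inter> b j = {y}"
    using ij by (auto elim: isolatesE)
  let ?C = "(adjacency G)\<^sup>* `` {x}" and ?D = "(adjacency G)\<^sup>* `` {y}"
  have "infinite ?C" "infinite ?D"
    using ij inf_iff[OF x] inf_iff[OF y] by blast+
  moreover have "?C \<in> clusters G" "?D \<in> clusters G"
    using x y unfolding clusters_def by (auto intro!: quotientI)
  moreover have "?C \<noteq> ?D"
  proof
    assume "?C = ?D"
    then have "(x, y) \<in> (adjacency G)\<^sup>*" by blast
    then have "(i, j) \<in> R"
      unfolding R_def by (rule base_adjacency_rtrancl_if_adjacency_rtrancl[OF b lf _ x y])
    with ij show False by blast
  qed
  ultimately show ?L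
    unfolding at_most_one_infinite_cluster_def by blast
qed

section \<open>Independence of what happens inside and outside a bounded set\<close>

lemma (in prob_space) indep_set_sigma_sets_single:
  assumes "Int_stable \<A>" "\<A> \<subseteq> events" "V \<in> events"
    and "\<And>A. A \<in> \<A> \<Longrightarrow> prob (A \<inter> V) = prob A * prob V"
  shows "indep_set (sigma_sets (space M) \<A>) (sigma_sets (space M) {V})"
  using assms by (intro indep_set_sigma_sets indep_setI) (auto simp: Int_stable_def)

lemma (in prob_space) expectation_mult_indicator_if_indep_set:
  assumes indep: "indep_set (sigma_sets (space M) \<A>) (sigma_sets (space M) {V})"
    and \<A>: "\<A> \<subseteq> Pow (space M)"
    and f: "f \<in> borel_measurable (sigma (space M) \<A>)" "integrable M f"
  shows "expectation (\<lambda>\<omega>. f \<omega> * indicator V \<omega>) = expectation f * prob V"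
proof -
  have V: "V \<in> events"
    using indep_setD_ev2[OF indep] by auto
  have "indep_var borel f borel (indicator V :: _ \<Rightarrow> real)"
    unfolding indep_var_eq
  proof (intro conjI)
    show "random_variable borel f"
      using f(2) by auto
    show "random_variable borel (indicator V :: _ \<Rightarrow> real)"
      using V by auto
    have 1: "sigma_sets (space M) {f -` A \<inter> space M |A. A \<in> sets borel} \<subseteq> sigma_sets (space M) \<A>"
      using measurable_sets[OF f(1)] \<A> by (intro sigma_sets_mono) auto
    have 2: "sigma_sets (space M) {(indicator V :: _ \<Rightarrow> real) -` A \<inter> space M |A. A \<in> sets borel}
        \<subseteq> sigma_sets (space M) {V}"
    proof (rule sigma_sets_mono)
      have "(indicator V :: _ \<Rightarrow> real) \<in> borel_measurable (sigma (space M) {V})"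
        using V sets.sets_into_space by (intro borel_measurable_indicator) auto
      from measurable_sets[OF this]
      show "{(indicator V :: _ \<Rightarrow> real) -` A \<inter> space M |A. A \<in> sets borel} \<subseteq> sigma_sets (space M) {V}"
        using V sets.sets_into_space[OF V] by auto
    qed
    show "indep_set (sigma_sets (space M) {f -` A \<inter> space M |A. A \<in> sets borel})
        (sigma_sets (space M) {(indicator V :: _ \<Rightarrow> real) -` A \<inter> space M |A. A \<in> sets borel})"
      using 1 2 indep_setD_ev1[OF indep] indep_setD_ev2[OF indep]
      by (intro indep_setI) (auto intro!: indep_setD[OF indep])
  qed
  then have "expectation (\<lambda>\<omega>. f \<omega> * indicator V \<omega>) = expectation f * expectation (indicator V)"
    using f(2) V by (intro indep_var_lebesgue_integral integrable_real_indicator) (auto simp: less_top[symmetric])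
  then show ?thesis
    using V by simp
qed

context random_connection
begin

definition outside_voids :: "'a set \<Rightarrow> 'w set set" where
  "outside_voids B = {void_event C | C. C \<in> sets borel \<and> C \<inter> B = {}}"

text \<open>
  Both \<open>C\<close> and the bound \<open>K\<close> for \<open>D\<close> avoid \<open>B\<close>, and intersecting two such events amounts to forming the
  unions of the sets \<open>C\<close> and of the sets \<open>D\<close>. Boundedness of \<open>K\<close> leaves finitely many possible edges in
  \<open>D\<close>, and symmetry makes each of them show up in both orders.
\<close>

definition outside_graph_events :: "'a set \<Rightarrow> 'w set set" where
  "outside_graph_events B =
     {no_edge_event D \<inter> void_event C | D C K.
        C \<in> sets borel \<and> C \<inter> B = {} \<and>
        D \<in> sets (borel \<Otimes>\<^sub>M borel) \<and> sym D \<and> D \<subseteq> K \<times> K \<and>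
        K \<in> sets borel \<and> bounded K \<and> K \<inter> B = {}}"

lemma indep_outside_voids:
  assumes B: "B \<in> sets borel"
  shows "indep_set (sigma_sets (space M) (outside_voids B)) (sigma_sets (space M) {void_event B})"
proof (rule indep_set_sigma_sets_single)
  show "Int_stable (outside_voids B)"
    unfolding Int_stable_def
  proof (intro ballI)
    fix E E' assume "E \<in> outside_voids B" "E' \<in> outside_voids B"
    then obtain C C' where C: "E = void_event C" "C \<in> sets borel" "C \<inter> B = {}"
        "E' = void_event C'" "C' \<in> sets borel" "C' \<inter> B = {}"
      unfolding outside_voids_def by blast
    have "E \<inter> E' = void_event (C \<union> C')"
      unfolding C by auto
    then show "E \<inter> E' \<in> outside_voids B"
      unfolding outside_voids_def using C by (intro CollectI exI[of _ "C \<union> C'"] conjI) auto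
  qed
  show "outside_voids B \<subseteq> events"
    using void_event_in_events by (auto simp: outside_voids_def)
  show "void_event B \<in> events"
    using B by (rule void_event_in_events)
  show "prob (E \<inter> void_event B) = prob E * prob (void_event B)" if "E \<in> outside_voids B" for E
    using that prob_void_event_Int[OF B] unfolding outside_voids_def by blast
qed

text \<open>
  Conditioning on \<open>\<eta>\<close> replaces the absence of edges by the product \<open>s\<close>, a function of the points
  outside \<open>B\<close>, and those are independent of the points in \<open>B\<close>.
\<close>

lemma prob_outside_graph_event_Int:
  assumes B: "B \<in> sets borel" and E: "E \<in> outside_graph_events B"
  shows "prob (E \<inter> void_event B) = prob E * prob (void_event B)"
proof -
  obtain D C K where E_eq: "E = no_edge_event D \<inter> void_event C"
    and C: "C \<in> sets borel" "C \<inter> B = {}"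
    and D: "D \<in> sets (borel \<Otimes>\<^sub>M borel)" "sym D" "D \<subseteq> K \<times> K"
    and K: "K \<in> sets borel" "bounded K" "K \<inter> B = {}"
    using E unfolding outside_graph_events_def by blast
  let ?V = "void_event B" and ?G = "sigma (space M) (outside_voids B)"
  define s where "s \<omega> = sqrt (\<Prod>(x, y)\<in>offdiag (P \<omega>) \<inter> D. 1 - \<phi> x y)" for \<omega>
  have voids: "outside_voids B \<subseteq> Pow (space M)"
    by (auto simp: outside_voids_def)
  have G: "space ?G = space M" "sets ?G = sigma_sets (space M) (outside_voids B)"
    using voids by auto
  have void_G: "void_event C' \<in> sets ?G" if "C' \<in> sets borel" "C' \<inter> B = {}" for C'
    unfolding G using that by (intro sigma_sets.Basic) (auto simp: outside_voids_def)
  have \<phi>: "case_prod \<phi> \<in> borel_measurable (borel \<Otimes>\<^sub>M borel)" "\<And>x y. 0 \<le> \<phi> x y" "\<And>x y. \<phi> x y \<le> 1"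
    using connection unfolding connection_function_def by blast+
  have s_G: "s \<in> borel_measurable ?G"
  proof -
    have "(\<lambda>z. 1 - case_prod \<phi> z) \<in> borel_measurable (borel \<Otimes>\<^sub>M borel)"
      using \<phi>(1) by simp
    then have "(\<lambda>\<omega>. \<Prod>z\<in>offdiag (P \<omega>) \<inter> D. 1 - case_prod \<phi> z) \<in> borel_measurable ?G"
    proof (rule measurable_prod_offdiag_if_void_measurable[where K=K, rotated -1])
      show "locally_finite_set (P \<omega>)" if "\<omega> \<in> space ?G" for \<omega>
        using that locally_finite_P by (simp add: G)
      show "{\<omega> \<in> space ?G. P \<omega> \<inter> C' = {}} \<in> sets ?G" if "C' \<in> sets borel" "C' \<subseteq> K" for C'
        using void_G[of C'] that K unfolding G(1) by blast
    qed (use K D in auto)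
    then show ?thesis
      unfolding s_def by (simp add: case_prod_unfold)
  qed
  have f_G: "(\<lambda>\<omega>. indicator (void_event C) \<omega> * s \<omega>) \<in> borel_measurable ?G"
    by (intro borel_measurable_times s_G borel_measurable_indicator void_G C)
  have "integrable M (\<lambda>\<omega>. indicator (void_event C) \<omega> * s \<omega>)"
  proof (rule integrable_const_bound[of _ 1])
    have "0 \<le> (\<Prod>(x, y)\<in>S. 1 - \<phi> x y)" "(\<Prod>(x, y)\<in>S. 1 - \<phi> x y) \<le> 1" for S
      using \<phi> by (auto intro!: prod_nonneg prod_le_1)
    then show "AE \<omega> in M. norm (indicator (void_event C) \<omega> * s \<omega>) \<le> 1"
      by (intro AE_I2) (auto simp: s_def indicator_def)
    have "subalgebra M ?G"
      unfolding subalgebra_def G using indep_setD_ev1[OF indep_outside_voids[OF B]] by simp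
    then show "(\<lambda>\<omega>. indicator (void_event C) \<omega> * s \<omega>) \<in> borel_measurable M"
      using f_G by (rule measurable_from_subalg)
  qed
  note indep = expectation_mult_indicator_if_indep_set[OF indep_outside_voids[OF B] voids f_G this]
  have bK: "bounded K" by fact
  have "prob (E \<inter> ?V) = prob ((void_event C \<inter> ?V) \<inter> no_edge_event D)"
    unfolding E_eq by (intro arg_cong[where f=prob]) auto
  also have "\<dots> = expectation (\<lambda>\<omega>. indicator (void_event C \<inter> ?V) \<omega> * s \<omega>)"
    unfolding s_def using prob_no_edge_event_Int[OF D bK] void_event_measurable C B by blast
  also have "\<dots> = expectation (\<lambda>\<omega>. (indicator (void_event C) \<omega> * s \<omega>) * indicator ?V \<omega>)"
    by (simp add: indicator_inter_arith mult_ac)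
  also have "\<dots> = expectation (\<lambda>\<omega>. indicator (void_event C) \<omega> * s \<omega>) * prob ?V"
    by (rule indep)
  also have "expectation (\<lambda>\<omega>. indicator (void_event C) \<omega> * s \<omega>) = prob (void_event C \<inter> no_edge_event D)"
    unfolding s_def using prob_no_edge_event_Int[OF D bK] void_event_measurable C by simp
  finally show ?thesis
    unfolding E_eq by (simp add: Int_commute)
qed

lemma outside_graph_events_in_events: "outside_graph_events B \<subseteq> events"
  using no_edge_event_in_events void_event_in_events by (auto simp: outside_graph_events_def intro!: sets.Int)

lemma indep_outside_graph:
  assumes B: "B \<in> sets borel"
  shows "indep_set (sigma_sets (space M) (outside_graph_events B)) (sigma_sets (space M) {void_event B})"
proof (rule indep_set_sigma_sets_single)
  show "Int_stable (outside_graph_events B)"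
    unfolding Int_stable_def
  proof (intro ballI)
    fix E E' assume "E \<in> outside_graph_events B" "E' \<in> outside_graph_events B"
    then obtain D C K D' C' K' where E: "E = no_edge_event D \<inter> void_event C"
        "C \<in> sets borel" "C \<inter> B = {}" "D \<in> sets (borel \<Otimes>\<^sub>M borel)" "sym D" "D \<subseteq> K \<times> K"
        "K \<in> sets borel" "bounded K" "K \<inter> B = {}"
      and E': "E' = no_edge_event D' \<inter> void_event C'"
        "C' \<in> sets borel" "C' \<inter> B = {}" "D' \<in> sets (borel \<Otimes>\<^sub>M borel)" "sym D'" "D' \<subseteq> K' \<times> K'"
        "K' \<in> sets borel" "bounded K'" "K' \<inter> B = {}"
      unfolding outside_graph_events_def by blast
    have inter: "E \<inter> E' = no_edge_event (D \<union> D') \<inter> void_event (C \<union> C')"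
      unfolding E(1) E'(1) by (auto simp: no_edge_in_def)
    have union: "C \<union> C' \<in> sets borel" "(C \<union> C') \<inter> B = {}" "D \<union> D' \<in> sets (borel \<Otimes>\<^sub>M borel)"
      "sym (D \<union> D')" "D \<union> D' \<subseteq> (K \<union> K') \<times> (K \<union> K')"
      "K \<union> K' \<in> sets borel" "bounded (K \<union> K')" "(K \<union> K') \<inter> B = {}"
      using E(2-) E'(2-) apply -
      subgoal by (rule sets.Un)
      subgoal by blast
      subgoal by (rule sets.Un)
      subgoal by (rule sym_Un)
      subgoal by blast
      subgoal by (rule sets.Un)
      subgoal by simp
      subgoal by blast
      done
    show "E \<inter> E' \<in> outside_graph_events B"
      unfolding outside_graph_events_def
      by (intro CollectI exI[of _ "D \<union> D'"] exI[of _ "C \<union> C'"] exI[of _ "K \<union> K'"] conjI inter union)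
  qed
  show "outside_graph_events B \<subseteq> events"
    by (rule outside_graph_events_in_events)
  show "void_event B \<in> events"
    using B by (rule void_event_in_events)
qed (rule prob_outside_graph_event_Int[OF B])

end

lemma simple_graph_induced_subgraph:
  assumes "simple_graph G"
  shows "simple_graph (induced_subgraph G W)"
  unfolding simple_graph_def
proof
  fix e assume "e \<in> edges (induced_subgraph G W)"
  then have e: "e \<in> edges G" "e \<subseteq> W"
    by (simp_all add: induced_subgraph_def)
  then obtain x y where "e = {x, y}" "x \<in> verts G" "y \<in> verts G" "x \<noteq> y"
    using assms unfolding simple_graph_def by blast
  with e(2) show "e \<in> {{x, y} |x y. x \<in> verts (induced_subgraph G W) \<and> y \<in> verts (induced_subgraph G W) \<and> x \<noteq> y}"
    by (auto simp: induced_subgraph_def)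
qed

context random_connection
begin

text \<open>
  Whether a base set isolates a vertex outside \<open>B\<close>, and whether two base sets are adjacent, is decided
  by finitely or countably many void and no-edge events outside \<open>B\<close>. Reachability is a countable
  union over the lengths of the paths.
\<close>

lemma two_infinite_clusters_outside_in_sigma_sets:
  assumes B: "B \<in> sets borel"
  shows "{\<omega> \<in> space M. \<not> at_most_one_infinite_cluster (induced_subgraph (\<xi> \<omega>) (- B))}
    \<in> sigma_sets (space M) (outside_graph_events B)"
proof -
  let ?H = "sigma (space M) (outside_graph_events B)"
  have "outside_graph_events B \<subseteq> Pow (space M)"
    using outside_graph_events_in_events sets.sets_into_space by blast
  then have H: "space ?H = space M" "sets ?H = sigma_sets (space M) (outside_graph_events B)"
    by simp_all
  have void_H: "void_event C \<in> sets ?H" if C: "C \<in> sets borel" "C \<inter> B = {}" for C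
  proof -
    have "no_edge_event {} \<inter> void_event C \<in> outside_graph_events B"
      unfolding outside_graph_events_def using C
      by (intro CollectI exI[of _ "{}"] exI[of _ C] conjI refl) (auto simp: sym_def)
    moreover have "no_edge_event {} \<inter> void_event C = void_event C"
      by (auto simp: no_edge_in_def)
    ultimately show ?thesis
      unfolding H by (metis sigma_sets.Basic)
  qed
  have no_edge_H: "no_edge_event (U \<times> V \<union> V \<times> U) \<in> sets ?H"
    if UV: "U \<in> sets borel" "V \<in> sets borel" "bounded U" "bounded V" "U \<inter> B = {}" "V \<inter> B = {}" for U V
  proof -
    have "no_edge_event (U \<times> V \<union> V \<times> U) \<inter> void_event {} \<in> outside_graph_events B"
      unfolding outside_graph_events_def using UV
      by (intro CollectI exI[of _ "U \<times> V \<union> V \<times> U"] exI[of _ "{}"] exI[of _ "U \<union> V"] conjI refl)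
        (auto simp: sym_def)
    moreover have "no_edge_event (U \<times> V \<union> V \<times> U) \<inter> void_event {} = no_edge_event (U \<times> V \<union> V \<times> U)"
      by auto
    ultimately show ?thesis
      unfolding H by (metis sigma_sets.Basic)
  qed
  obtain b :: "nat \<Rightarrow> 'a set" where b: "bounded_base b"
    using ex_bounded_base by auto
  have b_open: "open (b i)" "bounded (b i)" for i
    using b by (auto simp: bounded_base_def)
  have outside: "b i - B \<in> sets borel" "bounded (b i - B)" "(b i - B) \<inter> B = {}"
      "(b i \<inter> b j) - B \<in> sets borel" "((b i \<inter> b j) - B) \<inter> B = {}" for i j
    using b_open B by (simp_all add: bounded_diff) auto
  define G where "G \<omega> = induced_subgraph (\<xi> \<omega>) (- B)" for \<omega>
  have simple: "simple_graph (\<xi> \<omega>)" "verts (\<xi> \<omega>) = P \<omega>" if "\<omega> \<in> space M" for \<omega>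
    using rcm that by (auto simp: random_connection_model_def)
  have verts_G: "verts (G \<omega>) = P \<omega> - B" if "\<omega> \<in> space M" for \<omega>
    using simple[OF that] by (auto simp: G_def induced_subgraph_def)
  have simple_G: "simple_graph (G \<omega>)" if "\<omega> \<in> space M" for \<omega>
    using simple(1)[OF that] unfolding G_def by (rule simple_graph_induced_subgraph)
  have lf_G: "locally_finite_set (verts (G \<omega>))" if \<omega>: "\<omega> \<in> space M" for \<omega>
    using locally_finite_P[OF \<omega>] unfolding verts_G[OF \<omega>] locally_finite_set_def
    by (blast intro: finite_subset)
  have no_edge_G: "no_edge_in (G \<omega>) (b i \<times> b j) \<longleftrightarrow>
      no_edge_in (\<xi> \<omega>) ((b i - B) \<times> (b j - B) \<union> (b j - B) \<times> (b i - B))" for i j \<omega>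
    by (auto simp: no_edge_in_def G_def induced_subgraph_def insert_commute)

  have iso [measurable]: "Measurable.pred ?H (\<lambda>\<omega>. isolates (G \<omega>) (b i))" for i
  proof -
    have "(\<lambda>\<omega>. real (card (P \<omega> \<inter> (b i - B)))) \<in> borel_measurable ?H"
    proof (rule measurable_card_if_void_measurable[where K="- B"])
      show "locally_finite_set (P \<omega>)" if "\<omega> \<in> space ?H" for \<omega>
        using that locally_finite_P by (simp add: H(1))
      show "{\<omega> \<in> space ?H. P \<omega> \<inter> C = {}} \<in> sets ?H" if "C \<in> sets borel" "C \<subseteq> - B" for C
        unfolding H(1) using that by (intro void_H) auto
    qed (use outside in auto)
    then have "(\<lambda>\<omega>. real (card (P \<omega> \<inter> (b i - B)))) -` {1} \<inter> space ?H \<in> sets ?H"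
      by (rule measurable_sets) simp
    moreover have "{\<omega> \<in> space ?H. isolates (G \<omega>) (b i)} =
        (\<lambda>\<omega>. real (card (P \<omega> \<inter> (b i - B)))) -` {1} \<inter> space ?H"
    proof -
      have "isolates (G \<omega>) (b i) \<longleftrightarrow> real (card (P \<omega> \<inter> (b i - B))) = 1" if "\<omega> \<in> space M" for \<omega>
      proof -
        have "verts (G \<omega>) \<inter> b i = P \<omega> \<inter> (b i - B)"
          using verts_G[OF that] by auto
        then show ?thesis by (simp add: isolates_def)
      qed
      then show ?thesis unfolding H by auto
    qed
    ultimately show ?thesis
      by (simp add: pred_def)
  qed
  have adj: "Measurable.pred ?H (\<lambda>\<omega>. (i, j) \<in> base_adjacency (G \<omega>) b)" for i j
  proof -
    have 1 [measurable]: "Measurable.pred ?H (\<lambda>\<omega>. P \<omega> \<inter> (b i \<inter> b j - B) = {})"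
      unfolding pred_def H(1) by (rule void_H) (use outside in auto)
    have 2 [measurable]: "Measurable.pred ?H (\<lambda>\<omega>. no_edge_in (G \<omega>) (b i \<times> b j))"
      unfolding pred_def H(1) no_edge_G by (rule no_edge_H) (use outside in auto)
    have meas: "Measurable.pred ?H (\<lambda>\<omega>. isolates (G \<omega>) (b i) \<and> isolates (G \<omega>) (b j) \<and>
        (\<not> P \<omega> \<inter> (b i \<inter> b j - B) = {} \<or> \<not> no_edge_in (G \<omega>) (b i \<times> b j)))"
      by measurable
    have eq: "(i, j) \<in> base_adjacency (G \<omega>) b \<longleftrightarrow> isolates (G \<omega>) (b i) \<and> isolates (G \<omega>) (b j) \<and>
        (\<not> P \<omega> \<inter> (b i \<inter> b j - B) = {} \<or> \<not> no_edge_in (G \<omega>) (b i \<times> b j))" if "\<omega> \<in> space ?H" for \<omega>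
    proof -
      have "verts (G \<omega>) \<inter> (b i \<inter> b j) = P \<omega> \<inter> (b i \<inter> b j - B)"
        using verts_G that by (auto simp: H)
      then show ?thesis by (simp add: base_adjacency_def)
    qed
    show ?thesis
      by (rule measurable_cong[THEN iffD2, OF eq meas])
  qed
  have pow: "Measurable.pred ?H (\<lambda>\<omega>. (i, j) \<in> base_adjacency (G \<omega>) b ^^ n)" for i j n
  proof (induction n arbitrary: j)
    case 0
    then show ?case by simp
  next
    case (Suc n)
    have "Measurable.pred ?H (\<lambda>\<omega>. \<exists>l. (i, l) \<in> base_adjacency (G \<omega>) b ^^ n \<and> (l, j) \<in> base_adjacency (G \<omega>) b)"
      by (intro pred_intros_countable pred_intros_logic Suc.IH adj)
    then show ?case
      by (simp add: relcomp_unfold)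
  qed
  have reach: "Measurable.pred ?H (\<lambda>\<omega>. (i, j) \<in> (base_adjacency (G \<omega>) b)\<^sup>*)" for i j
    unfolding rtrancl_is_UN_relpow using pow by simp
  \<comment> \<open>The balls that test unboundedness may have any common centre.\<close>
  have "Measurable.pred ?H (\<lambda>\<omega>. \<exists>i j. isolates (G \<omega>) (b i) \<and> isolates (G \<omega>) (b j) \<and>
      (i, j) \<notin> (base_adjacency (G \<omega>) b)\<^sup>* \<and>
      (\<forall>n::nat. \<exists>k. (i, k) \<in> (base_adjacency (G \<omega>) b)\<^sup>* \<and> b k \<inter> ball undefined n = {}) \<and>
      (\<forall>n::nat. \<exists>k. (j, k) \<in> (base_adjacency (G \<omega>) b)\<^sup>* \<and> b k \<inter> ball undefined n = {}))"
    by (intro pred_intros_countable pred_intros_logic iso reach) auto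
  then have "Measurable.pred ?H (\<lambda>\<omega>. \<not> at_most_one_infinite_cluster (G \<omega>))"
    by (rule measurable_cong[THEN iffD1, rotated])
      (rule not_at_most_one_infinite_cluster_iff_base[OF b lf_G simple_G, symmetric]; simp add: H)
  then show ?thesis
    unfolding pred_def H G_def .
qed

lemma AE_at_most_one_infinite_cluster_outside:
  assumes B: "B \<in> sets borel" "bounded B"
    and unique: "AE \<omega> in M. at_most_one_infinite_cluster (\<xi> \<omega>)"
  shows "AE \<omega> in M. at_most_one_infinite_cluster (induced_subgraph (\<xi> \<omega>) (- B))"
proof -
  let ?A = "{\<omega> \<in> space M. \<not> at_most_one_infinite_cluster (induced_subgraph (\<xi> \<omega>) (- B))}"
  note A = two_infinite_clusters_outside_in_sigma_sets[OF B(1)]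
  have A_events: "?A \<in> events"
    using A indep_setD_ev1[OF indep_outside_graph[OF B(1)]] by auto
  have V_events: "void_event B \<in> events"
    using B(1) by (rule void_event_in_events)
  have same: "induced_subgraph (\<xi> \<omega>) (- B) = \<xi> \<omega>" if \<omega>: "\<omega> \<in> void_event B" for \<omega>
  proof -
    have "simple_graph (\<xi> \<omega>)" "verts (\<xi> \<omega>) = P \<omega>"
      using rcm \<omega> by (auto simp: random_connection_model_def)
    then have "verts (\<xi> \<omega>) \<subseteq> - B" "\<forall>e\<in>edges (\<xi> \<omega>). e \<subseteq> - B"
      using \<omega> unfolding simple_graph_def by blast+
    then show ?thesis
      by (cases "\<xi> \<omega>") (auto simp: induced_subgraph_def)
  qed
  have "AE \<omega> in M. \<omega> \<notin> ?A \<inter> void_event B"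
    using unique by eventually_elim (use same in auto)
  then have "prob (?A \<inter> void_event B) = 0"
    using A_events V_events by (subst prob_eq_0) auto
  moreover have "prob (?A \<inter> void_event B) = prob ?A * prob (void_event B)"
    by (rule indep_setD[OF indep_outside_graph[OF B(1)] A]) auto
  ultimately have "prob ?A = 0"
    using prob_void_event_pos[OF B] by simp
  then have "AE \<omega> in M. \<omega> \<notin> ?A"
    using prob_eq_0[OF A_events] by simp
  with AE_space show ?thesis
    by eventually_elim auto
qed

end

section \<open>Removing finitely many points\<close>

text \<open>
  The difference of two measures is turned into a measure by \<^const>\<open>measure_of\<close>, which yields the
  zero measure when the difference is not countably additive. Then there are no points at all.
\<close>

lemma points_diff_measure:
  assumes "sets \<mu> = sets borel"
  shows "points (diff_measure \<mu> \<nu>) = {} \<or>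
    points (diff_measure \<mu> \<nu>) = {x :: 'a::t1_space. emeasure \<mu> {x} - emeasure \<nu> {x} \<noteq> 0}"
proof -
  let ?m = "\<lambda>A. emeasure \<mu> A - emeasure \<nu> A"
  have "sigma_sets (space \<mu>) (sets \<mu>) = sets \<mu>"
    by (rule sets.sigma_sets_eq)
  then have "emeasure (diff_measure \<mu> \<nu>) {x} =
      (if measure_space (space \<mu>) (sets \<mu>) ?m then ?m {x} else 0)" for x
    using assms unfolding diff_measure_def by (simp add: emeasure_measure_of_conv)
  then show ?thesis
    by (cases "measure_space (space \<mu>) (sets \<mu>) ?m") (simp_all add: points_def)
qed

theorem corollary6p4:
  fixes M :: "'w measure"
    and \<Lambda> :: "'a::polish_space measure"
    and \<phi> :: "'a \<Rightarrow> 'a \<Rightarrow> real"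
    and \<eta> \<eta>\<^sub>0 :: "'w \<Rightarrow> 'a measure"
    and \<xi> :: "'w \<Rightarrow> 'a graph"
  assumes "prob_space M"
    and "locally_finite_measure \<Lambda>" and "diffuse \<Lambda>"
    and "connection_function \<Lambda> \<phi>"
    and "poisson_process M \<Lambda> \<eta>"
    and "random_connection_model M \<phi> \<eta> \<xi>"
    and "AE \<omega> in M. at_most_one_infinite_cluster (\<xi> \<omega>)"
    and "point_process M \<eta>\<^sub>0"
    and "AE \<omega> in M. emeasure (\<eta>\<^sub>0 \<omega>) UNIV < \<infinity>"
    and "AE \<omega> in M. \<eta>\<^sub>0 \<omega> \<le> \<eta> \<omega>"
  shows "AE \<omega> in M. at_most_one_infinite_cluster
           (induced_subgraph (\<xi> \<omega>) (points (diff_measure (\<eta> \<omega>) (\<eta>\<^sub>0 \<omega>))))"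
proof -
  interpret prob_space M by fact
  interpret random_connection M \<Lambda> \<phi> \<eta> \<xi>
    by unfold_locales fact+
  obtain b :: "nat \<Rightarrow> 'a set" where b: "bounded_base b"
    using ex_bounded_base by auto
  \<comment> \<open>The removed points depend on \<open>\<omega>\<close>, but the sets used to cut them out form a countable family.\<close>
  define B where "B js = (\<Union>i\<in>set js. b i)" for js
  have B: "B js \<in> sets borel" "bounded (B js)" for js
    using b by (auto simp: B_def bounded_base_def)
  have "AE \<omega> in M. \<forall>js. at_most_one_infinite_cluster (induced_subgraph (\<xi> \<omega>) (- B js))"
    unfolding AE_all_countable
    using AE_at_most_one_infinite_cluster_outside[OF B] assms(7) by blast
  with assms(9) AE_space show ?thesis
  proof eventually_elim
    case (elim \<omega>)
    let ?W = "points (diff_measure (\<eta> \<omega>) (\<eta>\<^sub>0 \<omega>))"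
    have verts: "verts (\<xi> \<omega>) = P \<omega>"  and simple: "simple_graph (\<xi> \<omega>)"
      using rcm elim(2) by (auto simp: random_connection_model_def)
    have cm: "counting_measure (\<eta> \<omega>)" "counting_measure (\<eta>\<^sub>0 \<omega>)"
      using counting_measure_\<eta>[OF elim(2)] assms(8) elim(2) space_counting_measure_algebra
      by (auto simp: point_process_def dest: measurable_space)
    from points_diff_measure[OF sets_counting_measure[OF cm(1)], of "\<eta>\<^sub>0 \<omega>"]
    consider "?W = {}" | "?W = {x. emeasure (\<eta> \<omega>) {x} - emeasure (\<eta>\<^sub>0 \<omega>) {x} \<noteq> 0}"
      by blast
    then show ?case
    proof cases
      case 1
      then show ?thesis
        by (simp add: at_most_one_infinite_cluster_def clusters_def induced_subgraph_def)
    next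
      case 2
      have mem_W: "x \<in> ?W \<longleftrightarrow> emeasure (\<eta> \<omega>) {x} - emeasure (\<eta>\<^sub>0 \<omega>) {x} \<noteq> 0" for x
        by (subst 2) simp
      have mem_P: "x \<in> P \<omega> \<longleftrightarrow> emeasure (\<eta> \<omega>) {x} \<noteq> 0"
        and mem_\<eta>\<^sub>0: "x \<in> points (\<eta>\<^sub>0 \<omega>) \<longleftrightarrow> emeasure (\<eta>\<^sub>0 \<omega>) {x} \<noteq> 0" for x
        by (simp_all add: points_def)
      have W: "?W \<subseteq> P \<omega>" "P \<omega> - ?W \<subseteq> points (\<eta>\<^sub>0 \<omega>)"
        unfolding subset_iff Diff_iff mem_W mem_P mem_\<eta>\<^sub>0 by auto
      have "finite (points (\<eta>\<^sub>0 \<omega>) \<inter> UNIV)"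
        using cm(2) elim(1) by (intro finite_points_if_finite_emeasure) auto
      then have fin: "finite (P \<omega> - ?W)"
        using W(2) by (auto intro: finite_subset)
      have "\<forall>x\<in>P \<omega>. \<exists>i. P \<omega> \<inter> b i = {x}"
        using isolating_base_set[OF b locally_finite_P[OF elim(2)], of _ UNIV] by auto
      then obtain i where i: "\<And>x. x \<in> P \<omega> \<Longrightarrow> P \<omega> \<inter> b (i x) = {x}"
        by metis
      obtain js where "set js = i ` (P \<omega> - ?W)"
        using finite_list[OF finite_imageI[OF fin, of i]] by (elim exE)
      then have "P \<omega> \<inter> B js = (\<Union>x\<in>P \<omega> - ?W. P \<omega> \<inter> b (i x))"
        by (simp add: B_def)
      also have "\<dots> = (\<Union>x\<in>P \<omega> - ?W. {x})"
        using i by (intro SUP_cong) auto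
      finally have eq: "P \<omega> - B js = ?W"
        using W(1) by blast
      then have "verts (\<xi> \<omega>) \<inter> ?W = verts (\<xi> \<omega>) \<inter> - B js"
        unfolding verts by blast
      moreover have "e \<subseteq> ?W \<longleftrightarrow> e \<subseteq> - B js" if "e \<in> edges (\<xi> \<omega>)" for e
        using edge_subset_verts[OF simple that] eq unfolding verts by blast
      then have "{e \<in> edges (\<xi> \<omega>). e \<subseteq> ?W} = {e \<in> edges (\<xi> \<omega>). e \<subseteq> - B js}"
        by blast
      ultimately have "induced_subgraph (\<xi> \<omega>) ?W = induced_subgraph (\<xi> \<omega>) (- B js)"
        by (simp only: induced_subgraph_def)
      with elim(3) show ?thesis by simp
    qed
  qed
qed

end
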